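(* Let $(M,(\,,))$ be a connected Riemannian manifold of dimension $m\ge 2$ satisfying the weak maximum principle for the Hessian, and let $\varphi:M\to\mathbb{R}^n$ be an isometric immersion whose image is contained in a non-degenerate cone $\mathcal{C}_{o,v,\theta}$, where $o\in\mathbb{R}^n$, $v\in\mathbb{S}^{n-1}$, $\theta\in(0,\pi/2)$. Assume the codimension restriction $$0<n-m<m$$ and suppose that there is a constant $\chi\ge0$ such that, for every $x\in M$ and every $2$-plane $\pi\le T_xM$, the sectional curvature of $M$ satisfies ${}^M\mathrm{Sect}_x(\pi)\le\chi^2$. Then $$\cos(\theta)\le\sqrt{d(\pi_v,\varphi(M))\,\frac{\chi}{A_1}},$$ where $\pi_v$ is the hyperplane orthogonal to $v$ passing through $o$ and $d(\pi_v,\varphi(M))$ is the Euclidean distance between $\pi_v$ and $\varphi(M)$.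
   Context: $\mathbb{R}^n$ carries its canonical flat metric $\langle\,,\rangle$. The cone is $$\mathcal{C}_{o,v,\theta}=\Big\{z\in\mathbb{R}^n\setminus\{o\}:\Big\langle\frac{z-o}{|z-o|},v\Big\rangle\ge\cos(\theta)\Big\},\qquad \theta\in(0,\pi/2).$$ The constant $A_1$ is $$A_1=\sup\Big\{\xi\alpha^2\sqrt{1-\alpha^2}\ :\ \xi\in(0,1),\ \alpha\in\big(0,\sqrt{1-\xi}\big)\Big\}.$$ The weak maximum principle for the Hessian holds on $M$ if for every $u\in C^2(M)$ with $u^*=\sup_Mu<+\infty$ there exists a sequence $\{x_k\}\subset M$ such that, for every $k\in\mathbb{N}$, $$u(x_k)>u^*-\frac1k,\qquad \sup_{v\in T_{x_k}M,\ |v|=1}\mathrm{Hess}_{x_k}u(v,v)<\frac1k.$$ *)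

theory Defs
  imports "HOL-Analysis.Analysis"
begin

section \<open>Smooth functions on open subsets of Euclidean space\<close>

primrec Ck_on :: "nat \<Rightarrow> 'e set \<Rightarrow> ('e::euclidean_space \<Rightarrow> 'f::real_normed_vector) \<Rightarrow> bool" where
  "Ck_on 0 S f \<longleftrightarrow> continuous_on S f"
| "Ck_on (Suc k) S f \<longleftrightarrow>
     (\<forall>x\<in>S. f differentiable (at x)) \<and>
     (\<forall>b\<in>Basis. Ck_on k S (\<lambda>x. frechet_derivative f (at x) b))"

definition smooth_on :: "'e set \<Rightarrow> ('e::euclidean_space \<Rightarrow> 'f::real_normed_vector) \<Rightarrow> bool" where
  "smooth_on S f \<longleftrightarrow> (\<forall>k. Ck_on k S f)"


section \<open>Manifolds\<close>

text \<open>A chart is a domain together with a coordinate map; only the values of the coordinate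
  map on the domain matter. The dimension of the manifold is \<open>CARD('m)\<close>.

  A tangent vector is given by its component vectors in all charts. It is normalised to be zero
  on those charts that do not contain the base point, so that it is determined by its components
  in any one chart around that point; see \<open>tangent_space\<close> below.\<close>

type_synonym ('a, 'm) chart = "'a set \<times> ('a \<Rightarrow> real ^ 'm)"

type_synonym ('a, 'm) tvec = "('a, 'm) chart \<Rightarrow> real ^ 'm"

record ('a, 'm::finite) rmanifold =
  mtop :: "'a topology"
  atlas :: "('a, 'm) chart set"
  metric :: "'a \<Rightarrow> ('a, 'm) tvec \<Rightarrow> ('a, 'm) tvec \<Rightarrow> real"

definition chart_dom :: "('a, 'm::finite) chart \<Rightarrow> 'a set" where
  "chart_dom c = fst c"

definition coord :: "('a, 'm::finite) chart \<Rightarrow> 'a \<Rightarrow> real ^ 'm" where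
  "coord c = snd c"

definition coord_inv :: "('a, 'm::finite) chart \<Rightarrow> real ^ 'm \<Rightarrow> 'a" where
  "coord_inv c = inv_into (chart_dom c) (coord c)"

definition is_chart :: "'a topology \<Rightarrow> ('a, 'm::finite) chart \<Rightarrow> bool" where
  "is_chart X c \<longleftrightarrow>
     openin X (chart_dom c) \<and> open (coord c ` chart_dom c) \<and>
     homeomorphic_map (subtopology X (chart_dom c)) (top_of_set (coord c ` chart_dom c)) (coord c)"

definition compatible :: "('a, 'm::finite) chart \<Rightarrow> ('a, 'm) chart \<Rightarrow> bool" where
  "compatible c d \<longleftrightarrow>
     smooth_on (coord c ` (chart_dom c \<inter> chart_dom d)) (coord d \<circ> coord_inv c)"

definition smooth_manifold :: "('a, 'm::finite) rmanifold \<Rightarrow> bool" where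
  "smooth_manifold M \<longleftrightarrow>
     Hausdorff_space (mtop M) \<and> second_countable (mtop M) \<and>
     (\<forall>c\<in>atlas M. is_chart (mtop M) c) \<and>
     (\<Union>c\<in>atlas M. chart_dom c) = topspace (mtop M) \<and>
     (\<forall>c\<in>atlas M. \<forall>d\<in>atlas M. compatible c d)"

definition Ck_manifold :: "nat \<Rightarrow> ('a, 'm::finite) rmanifold \<Rightarrow> ('a \<Rightarrow> 'f::real_normed_vector) \<Rightarrow> bool" where
  "Ck_manifold k M f \<longleftrightarrow> (\<forall>c\<in>atlas M. Ck_on k (coord c ` chart_dom c) (f \<circ> coord_inv c))"

definition smooth_map :: "('a, 'm::finite) rmanifold \<Rightarrow> ('a \<Rightarrow> 'f::real_normed_vector) \<Rightarrow> bool" where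
  "smooth_map M f \<longleftrightarrow> (\<forall>k. Ck_manifold k M f)"

definition charts_at :: "('a, 'm::finite) rmanifold \<Rightarrow> 'a \<Rightarrow> ('a, 'm) chart set" where
  "charts_at M x = {c \<in> atlas M. x \<in> chart_dom c}"

text \<open>An arbitrary chart around \<open>x\<close>. The differential, the Hessian and the curvature below are
  tensorial, so evaluating them in another chart around \<open>x\<close> gives the same value.\<close>

definition chart_at :: "('a, 'm::finite) rmanifold \<Rightarrow> 'a \<Rightarrow> ('a, 'm) chart" where
  "chart_at M x = (SOME c. c \<in> charts_at M x)"


section \<open>Tangent spaces\<close>

definition tangent_space :: "('a, 'm::finite) rmanifold \<Rightarrow> 'a \<Rightarrow> ('a, 'm) tvec set" where
  "tangent_space M x = {v.
     (\<forall>c\<in>charts_at M x. \<forall>d\<in>charts_at M x.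
        v d = frechet_derivative (coord d \<circ> coord_inv c) (at (coord c x)) (v c)) \<and>
     (\<forall>c. c \<notin> charts_at M x \<longrightarrow> v c = 0)}"

definition tcomb :: "real \<Rightarrow> ('a, 'm::finite) tvec \<Rightarrow> real \<Rightarrow> ('a, 'm) tvec \<Rightarrow> ('a, 'm) tvec" where
  "tcomb a v b w = (\<lambda>c. a *\<^sub>R v c + b *\<^sub>R w c)"

definition tzero :: "('a, 'm::finite) tvec" where
  "tzero = (\<lambda>c. 0)"

definition tindep :: "('a, 'm::finite) tvec \<Rightarrow> ('a, 'm) tvec \<Rightarrow> bool" where
  "tindep v w \<longleftrightarrow> (\<forall>a b. tcomb a v b w = tzero \<longrightarrow> a = 0 \<and> b = 0)"

text \<open>The coordinate vector field of the \<open>i\<close>-th coordinate of the chart \<open>c\<close>.\<close>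

definition coord_vec :: "('a, 'm::finite) rmanifold \<Rightarrow> ('a, 'm) chart \<Rightarrow> 'm \<Rightarrow> 'a \<Rightarrow> ('a, 'm) tvec" where
  "coord_vec M c i x = (\<lambda>d. if d \<in> charts_at M x
     then frechet_derivative (coord d \<circ> coord_inv c) (at (coord c x)) (axis i 1) else 0)"

definition differential ::
  "('a, 'm::finite) rmanifold \<Rightarrow> ('a \<Rightarrow> 'f::real_normed_vector) \<Rightarrow> 'a \<Rightarrow> ('a, 'm) tvec \<Rightarrow> 'f" where
  "differential M f x v =
     (let c = chart_at M x in frechet_derivative (f \<circ> coord_inv c) (at (coord c x)) (v c))"


section \<open>Riemannian metrics\<close>

definition metric_coeff :: "('a, 'm::finite) rmanifold \<Rightarrow> ('a, 'm) chart \<Rightarrow> 'm \<Rightarrow> 'm \<Rightarrow> 'a \<Rightarrow> real" where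
  "metric_coeff M c i j x = metric M x (coord_vec M c i x) (coord_vec M c j x)"

definition riemannian_manifold :: "('a, 'm::finite) rmanifold \<Rightarrow> bool" where
  "riemannian_manifold M \<longleftrightarrow>
     smooth_manifold M \<and>
     (\<forall>x\<in>topspace (mtop M). \<forall>v\<in>tangent_space M x.
        (\<forall>w\<in>tangent_space M x. metric M x v w = metric M x w v) \<and>
        (\<forall>w\<in>tangent_space M x. \<forall>z\<in>tangent_space M x. \<forall>a b.
           metric M x (tcomb a v b w) z = a * metric M x v z + b * metric M x w z) \<and>
        (v \<noteq> tzero \<longrightarrow> metric M x v v > 0)) \<and>
     (\<forall>c\<in>atlas M. \<forall>i j. smooth_on (coord c ` chart_dom c) (metric_coeff M c i j \<circ> coord_inv c))"

definition unit_tangent :: "('a, 'm::finite) rmanifold \<Rightarrow> 'a \<Rightarrow> ('a, 'm) tvec set" where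
  "unit_tangent M x = {v \<in> tangent_space M x. metric M x v v = 1}"

definition chart_partial :: "('a, 'm::finite) chart \<Rightarrow> 'm \<Rightarrow> ('a \<Rightarrow> real) \<Rightarrow> 'a \<Rightarrow> real" where
  "chart_partial c i f x = frechet_derivative (f \<circ> coord_inv c) (at (coord c x)) (axis i 1)"

definition metric_inv_coeff :: "('a, 'm::finite) rmanifold \<Rightarrow> ('a, 'm) chart \<Rightarrow> 'm \<Rightarrow> 'm \<Rightarrow> 'a \<Rightarrow> real" where
  "metric_inv_coeff M c i j x = matrix_inv (\<chi> i j. metric_coeff M c i j x) $ i $ j"

text \<open>\<open>christoffel M c k i j\<close> is the symbol with upper index \<open>k\<close> of the Levi-Civita connection,
  i.e. the \<open>k\<close>-th component of the covariant derivative of the \<open>j\<close>-th coordinate field along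
  the \<open>i\<close>-th one.\<close>

definition christoffel :: "('a, 'm::finite) rmanifold \<Rightarrow> ('a, 'm) chart \<Rightarrow> 'm \<Rightarrow> 'm \<Rightarrow> 'm \<Rightarrow> 'a \<Rightarrow> real" where
  "christoffel M c k i j x = (\<Sum>l\<in>UNIV. metric_inv_coeff M c k l x *
     (chart_partial c i (metric_coeff M c j l) x + chart_partial c j (metric_coeff M c i l) x
       - chart_partial c l (metric_coeff M c i j) x)) / 2"

text \<open>The Hessian \<open>Hess u (X, Y) = X (Y u) - (\<nabla>\<^sub>X Y) u\<close>.\<close>

definition hessian ::
  "('a, 'm::finite) rmanifold \<Rightarrow> ('a \<Rightarrow> real) \<Rightarrow> 'a \<Rightarrow> ('a, 'm) tvec \<Rightarrow> ('a, 'm) tvec \<Rightarrow> real" where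
  "hessian M u x v w = (let c = chart_at M x in
     \<Sum>i\<in>UNIV. \<Sum>j\<in>UNIV. v c $ i * w c $ j *
       (chart_partial c i (chart_partial c j u) x - (\<Sum>k\<in>UNIV. christoffel M c k i j x * chart_partial c k u x)))"

text \<open>\<open>riemann_coeff M c l i j k\<close> is the \<open>l\<close>-th component of \<open>R(X\<^sub>i, X\<^sub>j) X\<^sub>k\<close> for the coordinate
  fields \<open>X\<^sub>i\<close> and the sign convention \<open>R(X, Y) = \<nabla>\<^sub>X \<nabla>\<^sub>Y - \<nabla>\<^sub>Y \<nabla>\<^sub>X - \<nabla>\<^sub>[\<^sub>X\<^sub>,\<^sub>Y\<^sub>]\<close>.\<close>

definition riemann_coeff ::
  "('a, 'm::finite) rmanifold \<Rightarrow> ('a, 'm) chart \<Rightarrow> 'm \<Rightarrow> 'm \<Rightarrow> 'm \<Rightarrow> 'm \<Rightarrow> 'a \<Rightarrow> real" where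
  "riemann_coeff M c l i j k x =
     chart_partial c i (christoffel M c l j k) x - chart_partial c j (christoffel M c l i k) x
     + (\<Sum>p\<in>UNIV. christoffel M c l i p x * christoffel M c p j k x
                 - christoffel M c l j p x * christoffel M c p i k x)"

text \<open>\<open>riemann4 M x v w y z\<close> is the inner product of \<open>R(v, w) y\<close> with \<open>z\<close>.\<close>

definition riemann4 ::
  "('a, 'm::finite) rmanifold \<Rightarrow> 'a \<Rightarrow> ('a, 'm) tvec \<Rightarrow> ('a, 'm) tvec \<Rightarrow> ('a, 'm) tvec \<Rightarrow> ('a, 'm) tvec \<Rightarrow> real"
where
  "riemann4 M x v w y z = (let c = chart_at M x in
     \<Sum>i\<in>UNIV. \<Sum>j\<in>UNIV. \<Sum>k\<in>UNIV. \<Sum>l\<in>UNIV. \<Sum>q\<in>UNIV.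
       v c $ i * w c $ j * y c $ k * z c $ q *
       riemann_coeff M c l i j k x * metric_coeff M c l q x)"

text \<open>The sectional curvature at \<open>x\<close> of the plane spanned by two linearly independent tangent
  vectors; it does not depend on the choice of the basis of the plane.\<close>

definition sect_curv :: "('a, 'm::finite) rmanifold \<Rightarrow> 'a \<Rightarrow> ('a, 'm) tvec \<Rightarrow> ('a, 'm) tvec \<Rightarrow> real" where
  "sect_curv M x v w =
     riemann4 M x v w w v / (metric M x v v * metric M x w w - (metric M x v w)\<^sup>2)"


section \<open>Isometric immersions into Euclidean space and the weak maximum principle\<close>

definition immersion :: "('a, 'm::finite) rmanifold \<Rightarrow> ('a \<Rightarrow> 'f::euclidean_space) \<Rightarrow> bool" where
  "immersion M f \<longleftrightarrow> smooth_map M f \<and>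
     (\<forall>x\<in>topspace (mtop M). inj_on (differential M f x) (tangent_space M x))"

definition isometric_immersion :: "('a, 'm::finite) rmanifold \<Rightarrow> ('a \<Rightarrow> 'f::euclidean_space) \<Rightarrow> bool" where
  "isometric_immersion M f \<longleftrightarrow> immersion M f \<and>
     (\<forall>x\<in>topspace (mtop M). \<forall>v\<in>tangent_space M x. \<forall>w\<in>tangent_space M x.
        metric M x v w = differential M f x v \<bullet> differential M f x w)"

definition weak_max_principle_hessian :: "('a, 'm::finite) rmanifold \<Rightarrow> bool" where
  "weak_max_principle_hessian M \<longleftrightarrow>
     (\<forall>u :: 'a \<Rightarrow> real. Ck_manifold 2 M u \<and> bdd_above (u ` topspace (mtop M)) \<longrightarrow>
       (\<exists>x :: nat \<Rightarrow> 'a. \<forall>k\<ge>1.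
          x k \<in> topspace (mtop M) \<and>
          u (x k) > (SUP y\<in>topspace (mtop M). u y) - 1 / real k \<and>
          (SUP v\<in>unit_tangent M (x k). ereal (hessian M u (x k) v v)) < ereal (1 / real k)))"

definition nondeg_cone :: "'f::euclidean_space \<Rightarrow> 'f \<Rightarrow> real \<Rightarrow> 'f set" where
  "nondeg_cone p v \<theta> = {z. z \<noteq> p \<and> ((z - p) /\<^sub>R norm (z - p)) \<bullet> v \<ge> cos \<theta>}"

definition hyperplane_at :: "'f::euclidean_space \<Rightarrow> 'f \<Rightarrow> 'f set" where
  "hyperplane_at p v = {z. (z - p) \<bullet> v = 0}"

definition const_A1 :: real where
  "const_A1 = Sup {\<xi> * \<alpha>\<^sup>2 * sqrt (1 - \<alpha>\<^sup>2) | \<xi> \<alpha>.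
     0 < \<xi> \<and> \<xi> < 1 \<and> 0 < \<alpha> \<and> \<alpha> < sqrt (1 - \<xi>)}"

end

theory Submission
  imports Defs
begin

text \<open>Put \<open>a = \<alpha> cos \<theta>\<close> with \<open>0 < \<alpha> < 1\<close>, let \<open>T\<close> be the height of a point \<open>\<phi> x\<^sub>0\<close> over the hyperplane and
  let \<open>u\<close> be the restriction of \<open>F z = sqrt (T\<^sup>2 + a\<^sup>2 |z - p|\<^sup>2) - (z - p) \<bullet> v\<close> to the manifold. The cone
  condition gives \<open>u \<le> T\<close>, and \<open>u x\<^sub>0 > 0\<close>; hence the points \<open>x\<^sub>k\<close> of the weak maximum principle
  satisfy \<open>u x\<^sub>k > 0\<close>, which bounds \<open>|\<phi> x\<^sub>k - p|\<close> in terms of \<open>T\<close>. The codimension and curvature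
  hypotheses give, through the Gauss equation, a unit tangent vector \<open>X\<close> with
  \<open>|II(X, X)| \<le> \<chi>\<close>. As \<open>|grad F| \<le> 1\<close> on the cone, the Hessian of \<open>u\<close> at \<open>x\<^sub>k\<close> in the direction \<open>X\<close> is at
  least \<open>a\<^sup>2 (1 - \<alpha>\<^sup>2)\<^bsup>3/2\<^esup> / T - \<chi>\<close>, and it is less than \<open>1/k\<close>. So
  \<open>cos\<^sup>2 \<theta> \<alpha>\<^sup>2 (1 - \<alpha>\<^sup>2)\<^bsup>3/2\<^esup> \<le> \<chi> T\<close>, and the supremum over \<open>\<alpha>\<close> of \<open>\<alpha>\<^sup>2 (1 - \<alpha>\<^sup>2)\<^bsup>3/2\<^esup>\<close> is \<open>A\<^sub>1\<close>, because
  \<open>\<alpha> < sqrt (1 - \<xi>)\<close> amounts to \<open>\<xi> < 1 - \<alpha>\<^sup>2\<close>.\<close>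

section \<open>Calculus of repeatedly differentiable functions\<close>

definition pd :: "'m::finite \<Rightarrow> (real ^ 'm \<Rightarrow> 'b::real_normed_vector) \<Rightarrow> real ^ 'm \<Rightarrow> 'b" where
  "pd i f x = frechet_derivative f (at x) (axis i 1)"

lemma frechet_derivative_cong:
  assumes "open S" "x \<in> S" "\<And>y. y \<in> S \<Longrightarrow> f y = g y"
  shows "frechet_derivative f (at x) = frechet_derivative g (at x)"
proof -
  have "(f has_derivative D) (at x) \<longleftrightarrow> (g has_derivative D) (at x)" for D
    using has_derivative_transform_within_open[of f D x UNIV S g]
      has_derivative_transform_within_open[of g D x UNIV S f] assms by auto
  then show ?thesis by (simp add: frechet_derivative_def)
qed

lemma differentiable_cong_open:
  assumes "open S" "x \<in> S" "\<And>y. y \<in> S \<Longrightarrow> f y = g y"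
  shows "f differentiable (at x) \<longleftrightarrow> g differentiable (at x)"
proof -
  have "(f has_derivative D) (at x) \<longleftrightarrow> (g has_derivative D) (at x)" for D
    using has_derivative_transform_within_open[of f D x UNIV S g]
      has_derivative_transform_within_open[of g D x UNIV S f] assms by auto
  then show ?thesis by (simp add: differentiable_def)
qed

lemma pd_cong:
  assumes "open S" "x \<in> S" "\<And>y. y \<in> S \<Longrightarrow> f y = g y"
  shows "pd i f x = pd i g x"
  unfolding pd_def using frechet_derivative_cong[OF assms] by simp

lemma Ck_on_cong:
  assumes "open S" "\<And>y. y \<in> S \<Longrightarrow> f y = g y"
  shows "Ck_on k S f \<longleftrightarrow> Ck_on k S g"
  using assms(2)
proof (induction k arbitrary: f g)
  case 0
  then show ?case by (simp cong: continuous_on_cong)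
next
  case (Suc k)
  have "Ck_on k S (\<lambda>x. frechet_derivative f (at x) b) = Ck_on k S (\<lambda>x. frechet_derivative g (at x) b)" for b
    by (rule Suc.IH) (use frechet_derivative_cong[OF assms(1)] Suc.prems in metis)
  moreover have "\<forall>x\<in>S. f differentiable (at x) \<longleftrightarrow> g differentiable (at x)"
    using differentiable_cong_open[OF assms(1)] Suc.prems by blast
  ultimately show ?case by simp
qed

lemma Ck_on_imp_continuous_on: "Ck_on k S f \<Longrightarrow> continuous_on S f"
  by (cases k) (auto simp: continuous_at_imp_continuous_on differentiable_imp_continuous_within)

lemma Ck_on_Suc_D: "Ck_on (Suc k) S f \<Longrightarrow> Ck_on k S f"
proof (induction k arbitrary: f)
  case 0
  then show ?case using Ck_on_imp_continuous_on by (metis Ck_on.simps(1))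
next
  case (Suc k)
  then show ?case by (metis Ck_on.simps(2))
qed

lemma Ck_on_subset: "Ck_on k S f \<Longrightarrow> T \<subseteq> S \<Longrightarrow> Ck_on k T f"
  by (induction k arbitrary: f) (auto intro: continuous_on_subset)

lemma Ck_on_const: "Ck_on k S (\<lambda>x. c)"
  by (induction k arbitrary: c) auto

text \<open>Lets the closure proofs work with an explicit derivative \<open>D\<close> supplied by
  the derivative rules, where \<open>Ck_on\<close> itself speaks of
  \<open>frechet_derivative\<close>.\<close>

lemma Ck_on_SucI:
  assumes "open S" "\<And>x. x \<in> S \<Longrightarrow> (f has_derivative D x) (at x)"
    and "\<And>b. b \<in> Basis \<Longrightarrow> Ck_on k S (\<lambda>x. D x b)"
  shows "Ck_on (Suc k) S f"
proof -
  have "frechet_derivative f (at x) = D x" if "x \<in> S" for x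
    using assms(2)[OF that] frechet_derivative_at by metis
  then have "Ck_on k S (\<lambda>x. frechet_derivative f (at x) b)" if "b \<in> Basis" for b
    using assms(3)[OF that] Ck_on_cong[OF assms(1), of "\<lambda>x. frechet_derivative f (at x) b" "\<lambda>x. D x b" k] by simp
  then show ?thesis using assms(2) by (auto simp: differentiable_def)
qed

lemma Ck_on_Suc_has_derivative:
  "Ck_on (Suc k) S f \<Longrightarrow> x \<in> S \<Longrightarrow> (f has_derivative frechet_derivative f (at x)) (at x)"
  by (simp add: frechet_derivative_works[symmetric])

section \<open>Closure of repeated differentiability under algebraic operations\<close>

lemma Ck_on_add:
  assumes "open S" "Ck_on k S f" "Ck_on k S g"
  shows "Ck_on k S (\<lambda>x. f x + g x)"
  using assms(2,3)
proof (induction k arbitrary: f g)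
  case 0
  then show ?case by (simp add: continuous_on_add)
next
  case (Suc k)
  show ?case
    by (rule Ck_on_SucI[OF assms(1) has_derivative_add[OF Ck_on_Suc_has_derivative[OF Suc.prems(1)] Ck_on_Suc_has_derivative[OF Suc.prems(2)]]])
      (use Suc in auto)
qed

lemma Ck_on_inner:
  fixes f g :: "'e::euclidean_space \<Rightarrow> 'f::real_inner"
  assumes "open S" "Ck_on k S f" "Ck_on k S g"
  shows "Ck_on k S (\<lambda>x. f x \<bullet> g x)"
  using assms(2,3)
proof (induction k arbitrary: f g)
  case 0
  then show ?case by (simp add: continuous_on_inner)
next
  case (Suc k)
  show ?case
    by (rule Ck_on_SucI[OF assms(1) has_derivative_inner[OF Ck_on_Suc_has_derivative[OF Suc.prems(1)] Ck_on_Suc_has_derivative[OF Suc.prems(2)]]])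
      (use Suc.prems Suc.IH Suc.prems[THEN Ck_on_Suc_D] in \<open>auto intro!: Ck_on_add[OF assms(1)] simp: Suc.IH\<close>)
qed

lemma Ck_on_mult:
  fixes f g :: "'e::euclidean_space \<Rightarrow> real"
  assumes "open S" "Ck_on k S f" "Ck_on k S g"
  shows "Ck_on k S (\<lambda>x. f x * g x)"
  using Ck_on_inner[OF assms] by simp

lemma Ck_on_diff:
  assumes "open S" "Ck_on k S f" "Ck_on k S g"
  shows "Ck_on k S (\<lambda>x. f x - g x)"
  using assms(2,3)
proof (induction k arbitrary: f g)
  case 0
  then show ?case by (simp add: continuous_on_diff)
next
  case (Suc k)
  show ?case
    by (rule Ck_on_SucI[OF assms(1) has_derivative_diff[OF Ck_on_Suc_has_derivative[OF Suc.prems(1)] Ck_on_Suc_has_derivative[OF Suc.prems(2)]]])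
      (use Suc in auto)
qed

lemma Ck_on_inverse:
  fixes f :: "'e::euclidean_space \<Rightarrow> real"
  assumes "open S" "\<And>x. x \<in> S \<Longrightarrow> f x \<noteq> 0" "Ck_on k S f"
  shows "Ck_on k S (\<lambda>x. inverse (f x))"
  using assms(3)
proof (induction k)
  case 0
  then show ?case using assms(2) by (simp add: continuous_on_inverse)
next
  case (Suc k)
  have *: "Ck_on k S (\<lambda>x. inverse (f x))" using Suc Ck_on_Suc_D by blast
  \<comment> \<open>The derivative contains \<open>inverse (f x)\<close> again, which has order
    \<open>k\<close> by induction. The leading \<open>0 -\<close> replaces a minus sign, so that
    \<open>Ck_on_diff\<close> and \<open>Ck_on_const\<close> apply.\<close>
  have "((\<lambda>x. inverse (f x)) has_derivative
     (\<lambda>h. 0 - inverse (f x) * frechet_derivative f (at x) h * inverse (f x))) (at x)" if "x \<in> S" for x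
    using Deriv.has_derivative_inverse[OF assms(2)[OF that] Ck_on_Suc_has_derivative[OF Suc.prems that]] by simp
  from this show ?case
    by (rule Ck_on_SucI[OF assms(1)])
      (use Suc.prems * in \<open>auto intro!: Ck_on_mult[OF assms(1)] Ck_on_diff[OF assms(1)] Ck_on_const simp del: diff_0\<close>)
qed

text \<open>The derivative is f' / (2 sqrt f); the induction closes because order \<open>k\<close>
  of sqrt f passes to its reciprocal by \<open>Ck_on_inverse\<close>.\<close>

lemma Ck_on_sqrt:
  fixes f :: "'e::euclidean_space \<Rightarrow> real"
  assumes "open S" "\<And>x. x \<in> S \<Longrightarrow> f x > 0" "Ck_on k S f"
  shows "Ck_on k S (\<lambda>x. sqrt (f x))"
  using assms(3)
proof (induction k)
  case 0
  then show ?case by (simp add: continuous_on_real_sqrt)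
next
  case (Suc k)
  have *: "Ck_on k S (\<lambda>x. sqrt (f x))" using Suc Ck_on_Suc_D by blast
  have **: "Ck_on k S (\<lambda>x. inverse (sqrt (f x)))" 
    by (rule Ck_on_inverse[OF assms(1) _ *]) (use assms(2) in force)
  have "((\<lambda>x. sqrt (f x)) has_derivative
     (\<lambda>h. frechet_derivative f (at x) h * (inverse (sqrt (f x)) / 2))) (at x)" if "x \<in> S" for x
    using has_derivative_real_sqrt[OF assms(2)[OF that] Ck_on_Suc_has_derivative[OF Suc.prems that]] 
    by simp
  from this show ?case
  proof (rule Ck_on_SucI[OF assms(1)])
    fix b :: 'e assume "b \<in> Basis"
    then show "Ck_on k S (\<lambda>x. frechet_derivative f (at x) b * (inverse (sqrt (f x)) / 2))"
      using Suc.prems Ck_on_mult[OF assms(1) ** Ck_on_const[of k S "1/2"]]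
      by (intro Ck_on_mult[OF assms(1)]) auto
  qed
qed

lemma smooth_on_has_derivative:
  "smooth_on S f \<Longrightarrow> x \<in> S \<Longrightarrow> (f has_derivative frechet_derivative f (at x)) (at x)"
  unfolding smooth_on_def using Ck_on_Suc_has_derivative by blast

lemma smooth_on_pd: 
  assumes "smooth_on S f"
  shows "smooth_on S (pd i f)"
  unfolding smooth_on_def
proof
  fix k
  have "Ck_on (Suc k) S f" using assms by (simp add: smooth_on_def)
  moreover have "axis i (1::real) \<in> Basis" by (simp add: axis_in_Basis_iff)
  ultimately have "Ck_on k S (\<lambda>x. frechet_derivative f (at x) (axis i 1))" by simp
  moreover have "pd i f = (\<lambda>x. frechet_derivative f (at x) (axis i 1))" by (auto simp: pd_def)
  ultimately show "Ck_on k S (pd i f)" by simp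
qed

section \<open>Partial derivatives\<close>

lemma pd_eqI: "(f has_derivative D) (at x) \<Longrightarrow> pd i f x = D (axis i 1)"
  unfolding pd_def by (metis frechet_derivative_at)

lemma frechet_derivative_eq_sum_pd:
  fixes f :: "real ^ 'm::finite \<Rightarrow> 'b::real_normed_vector"
  assumes "f differentiable (at x)"
  shows "frechet_derivative f (at x) w = (\<Sum>i\<in>UNIV. (w $ i) *\<^sub>R pd i f x)"
proof -
  interpret linear "frechet_derivative f (at x)"
    using assms linear_frechet_derivative by blast
  have "w = (\<Sum>i\<in>UNIV. (w $ i) *\<^sub>R axis i 1)"
    by (simp add: vec_eq_iff axis_def if_distrib sum.delta cong: if_cong)
  then have "frechet_derivative f (at x) w = frechet_derivative f (at x) (\<Sum>i\<in>UNIV. (w $ i) *\<^sub>R axis i 1)"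
    by simp
  also have "\<dots> = (\<Sum>i\<in>UNIV. (w $ i) *\<^sub>R pd i f x)"
    by (simp add: sum scale pd_def)
  finally show ?thesis .
qed

lemma pd_inner:
  fixes f g :: "real ^ 'm::finite \<Rightarrow> 'b::real_inner"
  assumes "f differentiable (at x)" "g differentiable (at x)"
  shows "pd i (\<lambda>x. f x \<bullet> g x) x = f x \<bullet> pd i g x + pd i f x \<bullet> g x"
  using pd_eqI[OF has_derivative_inner[OF assms[unfolded frechet_derivative_works]]]
  by (simp add: pd_def)

lemma pd_mult:
  fixes f g :: "real ^ 'm::finite \<Rightarrow> real"
  assumes "f differentiable (at x)" "g differentiable (at x)"
  shows "pd i (\<lambda>x. f x * g x) x = f x * pd i g x + pd i f x * g x"
  using pd_inner[OF assms] by simp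

lemma pd_sum:
  fixes f :: "'k \<Rightarrow> real ^ 'm::finite \<Rightarrow> 'b::real_normed_vector"
  assumes "\<And>k. k \<in> K \<Longrightarrow> f k differentiable (at x)"
  shows "pd i (\<lambda>x. \<Sum>k\<in>K. f k x) x = (\<Sum>k\<in>K. pd i (f k) x)"
  using pd_eqI[OF has_derivative_sum[of K f "\<lambda>k. frechet_derivative (f k) (at x)" "at x"]] assms
  by (simp add: pd_def frechet_derivative_works)

section \<open>Symmetry of second partial derivatives\<close>

lemma DERIV_along_line:
  fixes h :: "'e::real_normed_vector \<Rightarrow> real"
  assumes "(h has_derivative D) (at (y + s *\<^sub>R a))"
  shows "((\<lambda>s. h (y + s *\<^sub>R a)) has_real_derivative D a) (at s)"
proof -
  have "((\<lambda>s. y + s *\<^sub>R a) has_derivative (\<lambda>t. t *\<^sub>R a)) (at s)"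
    by (auto intro!: derivative_eq_intros)
  from has_derivative_compose[OF this assms]
  have "((\<lambda>s. h (y + s *\<^sub>R a)) has_derivative (\<lambda>t. D (t *\<^sub>R a))) (at s)" .
  moreover have "(\<lambda>t. D (t *\<^sub>R a)) = (*) (D a)"
    using linear_scale[OF has_derivative_linear[OF assms]] by auto
  ultimately show ?thesis by (simp add: has_field_derivative_def)
qed

text \<open>The mean value theorem is applied twice: in direction \<open>i\<close> to the difference
  of \<open>h\<close> along two parallel sides of a square, then in direction \<open>j\<close> to
  the resulting difference of \<open>pd i h\<close>. The left side is symmetric in \<open>i\<close>
  and \<open>j\<close>, which is what the symmetry proof exploits.\<close>

lemma second_difference_mean_value:
  fixes h :: "real ^ 'm::finite \<Rightarrow> real"
  assumes h: "Ck_on 2 (ball x e) h" and t: "0 < t" "2 * t < e"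
  shows "\<exists>q. dist x q < 2 * t \<and>
    h (x + t *\<^sub>R axis i 1 + t *\<^sub>R axis j 1) - h (x + t *\<^sub>R axis i 1) - h (x + t *\<^sub>R axis j 1) + h x
      = t\<^sup>2 * pd j (pd i h) q"
proof -
  define a b :: "real ^ 'm" where "a = axis i 1" and "b = axis j 1"
  have n: "norm (s *\<^sub>R a + r *\<^sub>R b) \<le> s + r" if "0 \<le> s" "0 \<le> r" for s r
    using norm_triangle_ineq[of "s *\<^sub>R a" "r *\<^sub>R b"] that by (simp add: a_def b_def norm_axis_1)
  have d: "dist x (x + s *\<^sub>R a + r *\<^sub>R b) \<le> s + r" if "0 \<le> s" "0 \<le> r" for s r
    using n[OF that] by (metis add.assoc dist_add_cancel dist_0_norm add.right_neutral)
  have inb: "x + s *\<^sub>R a + r *\<^sub>R b \<in> ball x e" if "0 \<le> s" "0 \<le> r" "s \<le> t" "r \<le> t" for s r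
    using d[OF that(1,2)] that t by auto
  have h2: "Ck_on (Suc (Suc 0)) (ball x e) h" using h by (simp add: numeral_2_eq_2)
  have D1: "(h has_derivative frechet_derivative h (at y)) (at y)" if "y \<in> ball x e" for y
    using Ck_on_Suc_has_derivative[OF h2 that] .
  have "Ck_on (Suc 0) (ball x e) (pd i h)"
    using h2 by (simp add: pd_def[abs_def] axis_in_Basis_iff)
  then have D2: "(pd i h has_derivative frechet_derivative (pd i h) (at y)) (at y)" if "y \<in> ball x e" for y
    using Ck_on_Suc_has_derivative that by blast
  have P1: "((\<lambda>s. h (x + s *\<^sub>R a + r *\<^sub>R b)) has_real_derivative pd i h (x + s *\<^sub>R a + r *\<^sub>R b)) (at s)"
    if "0 \<le> s" "0 \<le> r" "s \<le> t" "r \<le> t" for s r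
    using DERIV_along_line[of h _ "x + r *\<^sub>R b" s a] D1[OF inb[OF that]]
    by (simp add: pd_def a_def algebra_simps)
  have P2: "((\<lambda>r. pd i h (x + s *\<^sub>R a + r *\<^sub>R b)) has_real_derivative pd j (pd i h) (x + s *\<^sub>R a + r *\<^sub>R b)) (at r)"
    if "0 \<le> s" "0 \<le> r" "s \<le> t" "r \<le> t" for s r
    using DERIV_along_line[of "pd i h" _ "x + s *\<^sub>R a" r b] D2[OF inb[OF that]]
    by (simp add: pd_def[of j] b_def)
  define f where "f s = h (x + s *\<^sub>R a + t *\<^sub>R b) - h (x + s *\<^sub>R a + 0 *\<^sub>R b)" for s
  have "(f has_real_derivative (pd i h (x + s *\<^sub>R a + t *\<^sub>R b) - pd i h (x + s *\<^sub>R a + 0 *\<^sub>R b))) (at s)"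
    if "0 \<le> s" "s \<le> t" for s
    unfolding f_def by (intro DERIV_diff P1) (use that t in auto)
  from MVT2[OF t(1) this] obtain s where s: "0 < s" "s < t"
    "f t - f 0 = t * (pd i h (x + s *\<^sub>R a + t *\<^sub>R b) - pd i h (x + s *\<^sub>R a + 0 *\<^sub>R b))"
    by auto
  have "\<exists>r>0. r < t \<and> pd i h (x + s *\<^sub>R a + t *\<^sub>R b) - pd i h (x + s *\<^sub>R a + 0 *\<^sub>R b)
      = (t - 0) * pd j (pd i h) (x + s *\<^sub>R a + r *\<^sub>R b)"
    by (rule MVT2[OF t(1)]) (use P2 s in auto)
  then obtain r where r: "0 < r" "r < t" "pd i h (x + s *\<^sub>R a + t *\<^sub>R b) - pd i h (x + s *\<^sub>R a + 0 *\<^sub>R b)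
      = t * pd j (pd i h) (x + s *\<^sub>R a + r *\<^sub>R b)" by auto
  have "dist x (x + s *\<^sub>R a + r *\<^sub>R b) < 2 * t" using d[of s r] s r by auto
  moreover have "f t - f 0 = t\<^sup>2 * pd j (pd i h) (x + s *\<^sub>R a + r *\<^sub>R b)"
    using s(3) r(3) by (simp add: power2_eq_square)
  ultimately show ?thesis unfolding f_def a_def b_def by (intro exI conjI) (assumption, simp add: algebra_simps)
qed

lemma continuous_on_pd_pd:
  assumes "Ck_on 2 U f"
  shows "continuous_on U (pd i (pd j f))"
  using assms by (simp add: numeral_2_eq_2 pd_def[abs_def] axis_in_Basis_iff)

text \<open>One and the same second difference equals \<open>t\<^sup>2\<close> times either mixed
  derivative, each at some point within 2 t of \<open>x\<close>. By continuity the two mixed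
  derivatives then cannot differ at \<open>x\<close>.\<close>

lemma pd_commute_real:
  fixes h :: "real ^ 'm::finite \<Rightarrow> real"
  assumes U: "open U" "x \<in> U" and h: "Ck_on 2 U h"
  shows "pd i (pd j h) x = pd j (pd i h) x"
proof (rule ccontr)
  define F G where "F = pd i (pd j h)" and "G = pd j (pd i h)"
  assume "pd i (pd j h) x \<noteq> pd j (pd i h) x"
  \<comment> \<open>Half the gap: values within \<epsilon> of \<open>F x\<close> and of
    \<open>G x\<close> cannot coincide.\<close>
  define \<epsilon> where "\<epsilon> = \<bar>F x - G x\<bar> / 2"
  have \<epsilon>: "\<epsilon> > 0" using \<open>_ \<noteq> _\<close> by (simp add: \<epsilon>_def F_def G_def)
  obtain e where e: "e > 0" "ball x e \<subseteq> U" using U openE by blast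
  have c: "continuous_on (ball x e) F" "continuous_on (ball x e) G"
    using continuous_on_pd_pd[OF h] e continuous_on_subset unfolding F_def G_def by blast+
  then have "isCont F x" "isCont G x" using e by (auto simp: continuous_on_eq_continuous_at)
  then obtain d1 d2 where d: "d1 > 0" "d2 > 0"
    "\<And>y. dist y x < d1 \<Longrightarrow> dist (F y) (F x) < \<epsilon>" "\<And>y. dist y x < d2 \<Longrightarrow> dist (G y) (G x) < \<epsilon>"
    using \<epsilon> unfolding continuous_at_eps_delta by metis
  define t where "t = Min {e, d1, d2} / 3"
  have t: "0 < t" "2 * t < e" "2 * t < d1" "2 * t < d2" using e d by (auto simp: t_def min_def)
  have he: "Ck_on 2 (ball x e) h" using h e Ck_on_subset by blast
  obtain q1 where q1: "dist x q1 < 2 * t" "h (x + t *\<^sub>R axis i 1 + t *\<^sub>R axis j 1) - h (x + t *\<^sub>R axis i 1) - h (x + t *\<^sub>R axis j 1) + h x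
      = t\<^sup>2 * G q1" using second_difference_mean_value[OF he t(1,2), of i j] unfolding G_def by blast
  obtain q2 where q2: "dist x q2 < 2 * t" "h (x + t *\<^sub>R axis j 1 + t *\<^sub>R axis i 1) - h (x + t *\<^sub>R axis j 1) - h (x + t *\<^sub>R axis i 1) + h x
      = t\<^sup>2 * F q2" using second_difference_mean_value[OF he t(1,2), of j i] unfolding F_def by blast
  have "x + t *\<^sub>R axis j 1 + t *\<^sub>R axis i 1 = x + t *\<^sub>R axis i 1 + t *\<^sub>R axis j 1" by simp
  from q2(2)[unfolded this] q1(2) have "t\<^sup>2 * G q1 = t\<^sup>2 * F q2" by linarith
  then have "G q1 = F q2" using t by simp
  moreover have "dist (F q2) (F x) < \<epsilon>" "dist (G q1) (G x) < \<epsilon>"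
    using d(3)[of q2] d(4)[of q1] q1 q2 t by (auto simp: dist_commute)
  ultimately show False by (auto simp: \<epsilon>_def dist_real_def abs_if split: if_splits)
qed

lemma pd_inner_const:
  fixes f :: "real ^ 'm::finite \<Rightarrow> 'b::real_inner"
  assumes "f differentiable (at x)"
  shows "pd i (\<lambda>x. f x \<bullet> c) x = pd i f x \<bullet> c"
  using pd_inner[OF assms differentiable_const[of c]] by (simp add: pd_def)

text \<open>Inner products with an arbitrary constant vector reduce the claim to real-valued
  functions.\<close>

lemma pd_commute:
  fixes f :: "real ^ 'm::finite \<Rightarrow> 'b::real_inner"
  assumes U: "open U" "x \<in> U" and f: "Ck_on 2 U f"
  shows "pd i (pd j f) x = pd j (pd i f) x"
proof -
  have f2: "Ck_on (Suc (Suc 0)) U f" using f by (simp add: numeral_2_eq_2)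
  have d1: "f differentiable (at y)" if "y \<in> U" for y using f2 that by simp
  have d2: "pd k f differentiable (at y)" if "y \<in> U" for y k
    using f2 that by (simp add: pd_def[abs_def] axis_in_Basis_iff)
  have *: "pd i (pd j (\<lambda>x. f x \<bullet> c)) x = pd i (pd j f) x \<bullet> c" for i j and c :: 'b
  proof -
    have "pd i (pd j (\<lambda>x. f x \<bullet> c)) x = pd i (\<lambda>x. pd j f x \<bullet> c) x"
      by (rule pd_cong[OF U]) (simp add: pd_inner_const d1)
    then show ?thesis by (simp add: pd_inner_const d2 U)
  qed
  have "pd i (pd j f) x \<bullet> c = pd j (pd i f) x \<bullet> c" for c
    using pd_commute_real[OF U Ck_on_inner[OF U(1) f Ck_on_const], of i j c] * by metis
  then show ?thesis by (metis vector_eq_rdot)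
qed

text \<open>By the Leibniz formula the determinant is polynomial in the entries. With Cramer's rule
  this makes the Christoffel symbols differentiable.\<close>

lemma differentiable_det:
  fixes A :: "'e::real_normed_vector \<Rightarrow> real ^ 'm::finite ^ 'm"
  assumes "\<And>i j. (\<lambda>x. A x $ i $ j) differentiable (at x)"
  shows "(\<lambda>x. det (A x)) differentiable (at x)"
proof -
  have "((\<lambda>x. \<Prod>i\<in>UNIV. A x $ i $ p i) has_derivative
     (\<lambda>y. \<Sum>i\<in>UNIV. frechet_derivative (\<lambda>x. A x $ i $ p i) (at x) y * (\<Prod>j\<in>UNIV - {i}. A x $ j $ p j))) (at x)" for p
    by (rule has_derivative_prod) (use assms in \<open>simp add: frechet_derivative_works\<close>)
  then have "(\<lambda>x. \<Prod>i\<in>UNIV. A x $ i $ p i) differentiable (at x)" for p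
    unfolding differentiable_def by blast
  then show ?thesis
    unfolding det_def by (intro differentiable_sum differentiable_mult differentiable_const) auto
qed

section \<open>The Gauss equation in a chart\<close>

text \<open>The first fundamental form, that is, the Euclidean metric pulled back by
  \<open>f\<close>.\<close>

definition "gram f x = (\<chi> i j. pd i f x \<bullet> pd j f x)"
  for f :: "real ^ 'm::finite \<Rightarrow> 'b::real_inner"

text \<open>The Christoffel symbols of the induced metric, obtained as coefficients of the
  tangential part of the second derivatives of \<open>f\<close>, without differentiating the metric.
  \<open>christoffel_eq\<close> matches them with the usual formula.\<close>

definition "gamma f k i j x = (\<Sum>l\<in>UNIV. matrix_inv (gram f x) $ k $ l * (pd i (pd j f) x \<bullet> pd l f x))"
  for f :: "real ^ 'm::finite \<Rightarrow> 'b::real_inner"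

text \<open>The second fundamental form on coordinate fields: the normal part of the second
  derivatives.\<close>

definition "sff f i j x = pd i (pd j f) x - (\<Sum>k\<in>UNIV. gamma f k i j x *\<^sub>R pd k f x)"
  for f :: "real ^ 'm::finite \<Rightarrow> 'b::real_inner"

text \<open>Mirrors \<open>riemann_coeff\<close>, so that the Gauss equation becomes a statement of
  calculus on an open set of coordinates.\<close>

definition "curv_coeff f l i j k x =
     pd i (gamma f l j k) x - pd j (gamma f l i k) x
     + (\<Sum>p\<in>UNIV. gamma f l i p x * gamma f p j k x - gamma f l j p x * gamma f p i k x)"
  for f :: "real ^ 'm::finite \<Rightarrow> 'b::real_inner"

locale local_immersion =
  fixes f :: "real ^ 'm::finite \<Rightarrow> 'b::real_inner" and U
  assumes U: "open U" and f: "smooth_on U f"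
    and inj: "\<And>x w. x \<in> U \<Longrightarrow> frechet_derivative f (at x) w = 0 \<Longrightarrow> w = 0"
begin

lemma f_differentiable: "x \<in> U \<Longrightarrow> f differentiable (at x)"
  using smooth_on_has_derivative[OF f] by (auto simp: differentiable_def)

lemma pd_differentiable: "x \<in> U \<Longrightarrow> pd i f differentiable (at x)"
  using smooth_on_has_derivative[OF smooth_on_pd[OF f]] by (auto simp: differentiable_def)

lemma pd_pd_differentiable: "x \<in> U \<Longrightarrow> pd i (pd j f) differentiable (at x)"
  using smooth_on_has_derivative[OF smooth_on_pd[OF smooth_on_pd[OF f]]] by (auto simp: differentiable_def)

lemma pd_pd_commute: "x \<in> U \<Longrightarrow> pd i (pd j f) x = pd j (pd i f) x"
  using pd_commute[OF U] f unfolding smooth_on_def by blast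

lemma pd_pd_pd_commute: "x \<in> U \<Longrightarrow> pd i (pd j (pd k f)) x = pd j (pd i (pd k f)) x"
  using pd_commute[OF U, of x "pd k f"] smooth_on_pd[OF f] unfolding smooth_on_def by blast

lemma gram_mult: "(gram f x *v w) $ i = pd i f x \<bullet> (\<Sum>j\<in>UNIV. w $ j *\<^sub>R pd j f x)"
  by (simp add: gram_def matrix_vector_mult_def inner_sum_right mult.commute)

text \<open>If the Gram matrix annihilates \<open>w\<close>, then the image of \<open>w\<close>
  under the derivative of \<open>f\<close> has squared norm 0, so \<open>w = 0\<close> by
  injectivity.\<close>

lemma gram_invertible:
  assumes "x \<in> U"
  shows "invertible (gram f x)"
proof -
  have "w = 0" if "gram f x *v w = 0" for w
  proof -
    let ?W = "\<Sum>j\<in>UNIV. w $ j *\<^sub>R pd j f x"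
    have "?W \<bullet> ?W = (\<Sum>i\<in>UNIV. w $ i * ((gram f x *v w) $ i))"
      by (simp add: gram_mult inner_sum_left)
    then have "?W = 0" using that by simp
    then have "frechet_derivative f (at x) w = 0"
      by (simp add: frechet_derivative_eq_sum_pd f_differentiable assms)
    then show ?thesis using inj assms by blast
  qed
  then show ?thesis
    by (simp add: invertible_left_inverse matrix_left_invertible_ker)
qed

lemma gram_inv: 
  assumes "x \<in> U"
  shows "gram f x ** matrix_inv (gram f x) = mat 1" 
  using someI_ex[OF gram_invertible[OF assms, unfolded invertible_def]] by (simp add: matrix_inv_def)

lemma gram_gamma:
  assumes "x \<in> U"
  shows "gram f x *v (\<chi> k. gamma f k i j x) = (\<chi> q. pd i (pd j f) x \<bullet> pd q f x)"
proof -
  have "(\<chi> k. gamma f k i j x) = matrix_inv (gram f x) *v (\<chi> q. pd i (pd j f) x \<bullet> pd q f x)"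
    by (simp add: vec_eq_iff gamma_def matrix_vector_mult_def)
  then show ?thesis by (simp add: matrix_vector_mul_assoc gram_inv[OF assms])
qed

lemma gamma_gram:
  assumes "x \<in> U"
  shows "(\<Sum>l\<in>UNIV. gamma f l i j x * (pd l f x \<bullet> pd q f x)) = pd i (pd j f) x \<bullet> pd q f x"
proof -
  have "(gram f x *v (\<chi> k. gamma f k i j x)) $ q = pd i (pd j f) x \<bullet> pd q f x"
    using gram_gamma[OF assms] by simp
  then show ?thesis by (simp add: matrix_vector_mult_def gram_def inner_commute mult.commute)
qed

lemma sff_normal: "x \<in> U \<Longrightarrow> sff f i j x \<bullet> pd q f x = 0"
  using gamma_gram[of x i j q] by (simp add: sff_def inner_diff_left inner_sum_left)

lemma sff_normal': "x \<in> U \<Longrightarrow> sff f i j x \<bullet> frechet_derivative f (at x) w = 0"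
  using sff_normal by (simp add: frechet_derivative_eq_sum_pd[OF f_differentiable] inner_sum_right)

lemma gamma_sym: "x \<in> U \<Longrightarrow> gamma f k i j x = gamma f k j i x"
  by (simp add: gamma_def pd_pd_commute[of x i j])

lemma sff_sym: "x \<in> U \<Longrightarrow> sff f i j x = sff f j i x"
  by (simp add: sff_def pd_pd_commute[of x i j] gamma_sym[of x _ i j])

text \<open>Cramer's rule gives the differentiability of the Christoffel symbols.\<close>

lemma gamma_differentiable:
  assumes x: "x \<in> U"
  shows "gamma f k i j differentiable (at x)"
proof -
  define A where "A y = (\<chi> a b. if b = k then pd i (pd j f) y \<bullet> pd a f y else gram f y $ a $ b)" for y
  have nz: "det (gram f y) \<noteq> 0" if "y \<in> U" for y
    using gram_invertible[OF that] by (simp add: invertible_det_nz)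
  have eq: "gamma f k i j y = det (A y) / det (gram f y)" if "y \<in> U" for y
  proof -
    have "(\<chi> k. gamma f k i j y) = (\<chi> k. det (\<chi> a b. if b = k
        then (\<chi> q. pd i (pd j f) y \<bullet> pd q f y) $ a else gram f y $ a $ b) / det (gram f y))"
      using cramer[OF nz[OF that]] gram_gamma[OF that] by blast
    from arg_cong[OF this, of "\<lambda>v. v $ k"] show ?thesis
      unfolding A_def vec_lambda_beta .
  qed
  have "(\<lambda>y. det (gram f y)) differentiable (at x)"
    by (rule differentiable_det) (simp add: gram_def pd_differentiable[OF x])
  moreover have "(\<lambda>y. det (A y)) differentiable (at x)"
  proof (rule differentiable_det)
    fix a b
    show "(\<lambda>y. A y $ a $ b) differentiable (at x)"
      by (cases "b = k") (simp_all add: A_def gram_def pd_differentiable[OF x] pd_pd_differentiable[OF x])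
  qed
  ultimately have "(\<lambda>y. det (A y) / det (gram f y)) differentiable (at x)"
    using nz[OF x] by simp
  then show ?thesis
    using differentiable_cong_open[OF U x, of "gamma f k i j" "\<lambda>y. det (A y) / det (gram f y)"] eq by blast
qed

text \<open>Product rule applied to the identity \<open>gamma_gram\<close> in direction
  \<open>i\<close>. The terms in which \<open>pd q f\<close> is differentiated combine into the one
  with \<open>sff\<close>.\<close>

lemma pd_gamma_gram:
  assumes x: "x \<in> U"
  shows "(\<Sum>l\<in>UNIV. pd i (gamma f l j k) x * (pd l f x \<bullet> pd q f x)) =
    pd i (pd j (pd k f)) x \<bullet> pd q f x + sff f j k x \<bullet> pd i (pd q f) x
    - (\<Sum>l\<in>UNIV. gamma f l j k x * (pd i (pd l f) x \<bullet> pd q f x))"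
proof -
  have "pd i (\<lambda>x. \<Sum>l\<in>UNIV. gamma f l j k x * (pd l f x \<bullet> pd q f x)) x
      = pd i (\<lambda>x. pd j (pd k f) x \<bullet> pd q f x) x"
    by (rule pd_cong[OF U x]) (rule gamma_gram)
  moreover have "pd i (\<lambda>x. \<Sum>l\<in>UNIV. gamma f l j k x * (pd l f x \<bullet> pd q f x)) x
    = (\<Sum>l\<in>UNIV. gamma f l j k x * (pd l f x \<bullet> pd i (pd q f) x + pd i (pd l f) x \<bullet> pd q f x)
         + pd i (gamma f l j k) x * (pd l f x \<bullet> pd q f x))"
    by (simp add: pd_sum pd_mult pd_inner gamma_differentiable pd_differentiable pd_pd_differentiable x)
  moreover have "pd i (\<lambda>x. pd j (pd k f) x \<bullet> pd q f x) x
     = pd j (pd k f) x \<bullet> pd i (pd q f) x + pd i (pd j (pd k f)) x \<bullet> pd q f x"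
    by (simp add: pd_inner pd_differentiable pd_pd_differentiable x)
  ultimately show ?thesis
    by (simp add: sff_def inner_diff_left inner_sum_left sum.distrib distrib_left)
qed

lemma sff_pd_pd: 
  assumes x: "x \<in> U"
  shows "sff f j k x \<bullet> pd i (pd q f) x = sff f j k x \<bullet> sff f i q x"
  by (subst (2) sff_def) (simp add: inner_diff_right inner_sum_right sff_normal[OF x])

text \<open>\<open>pd_gamma_gram\<close> is subtracted from itself with \<open>i\<close> and
  \<open>j\<close> exchanged. Third derivatives cancel by symmetry, and the remaining sums cancel
  against the quadratic terms of the curvature, evaluated in \<open>quad\<close>.\<close>

lemma gauss_equation:
  assumes x: "x \<in> U"
  shows "(\<Sum>l\<in>UNIV. curv_coeff f l i j k x * (pd l f x \<bullet> pd q f x)) =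
     sff f j k x \<bullet> sff f i q x - sff f i k x \<bullet> sff f j q x"
proof -
  have quad: "(\<Sum>l\<in>UNIV. (\<Sum>p\<in>UNIV. gamma f l i p x * gamma f p j k x) * (pd l f x \<bullet> pd q f x))
     = (\<Sum>p\<in>UNIV. gamma f p j k x * (pd i (pd p f) x \<bullet> pd q f x))" for i j
  proof -
    have "(\<Sum>l\<in>UNIV. (\<Sum>p\<in>UNIV. gamma f l i p x * gamma f p j k x) * (pd l f x \<bullet> pd q f x))
      = (\<Sum>p\<in>UNIV. \<Sum>l\<in>UNIV. gamma f l i p x * gamma f p j k x * (pd l f x \<bullet> pd q f x))"
      by (subst sum.swap) (simp add: sum_distrib_right)
    also have "\<dots> = (\<Sum>p\<in>UNIV. gamma f p j k x * (\<Sum>l\<in>UNIV. gamma f l i p x * (pd l f x \<bullet> pd q f x)))"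
      by (simp add: sum_distrib_left mult_ac)
    finally show ?thesis by (simp add: gamma_gram[OF x])
  qed
  have "(\<Sum>l\<in>UNIV. curv_coeff f l i j k x * (pd l f x \<bullet> pd q f x)) =
     (\<Sum>l\<in>UNIV. pd i (gamma f l j k) x * (pd l f x \<bullet> pd q f x))
     - (\<Sum>l\<in>UNIV. pd j (gamma f l i k) x * (pd l f x \<bullet> pd q f x))
     + (\<Sum>l\<in>UNIV. (\<Sum>p\<in>UNIV. gamma f l i p x * gamma f p j k x) * (pd l f x \<bullet> pd q f x))
     - (\<Sum>l\<in>UNIV. (\<Sum>p\<in>UNIV. gamma f l j p x * gamma f p i k x) * (pd l f x \<bullet> pd q f x))"
    by (simp add: curv_coeff_def sum_subtractf sum.distrib algebra_simps)
  also have "\<dots> = sff f j k x \<bullet> pd i (pd q f) x - sff f i k x \<bullet> pd j (pd q f) x"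
    unfolding quad pd_gamma_gram[OF x] by (simp add: pd_pd_pd_commute[OF x, of i j])
  finally show ?thesis by (simp add: sff_pd_pd[OF x])
qed

end

section \<open>An algebraic lemma of Otsuki type\<close>

text \<open>Near 0 a nonzero linear term dominates the quadratic one and takes both signs.\<close>

lemma linear_coeff_zero:
  fixes b c K :: real
  assumes "\<And>t. \<bar>t\<bar> \<le> 1 \<Longrightarrow> 0 \<le> b * t + K * t\<^sup>2"
  shows "b = 0"
proof (rule ccontr)
  assume b: "b \<noteq> 0"
  \<comment> \<open>\<open>D\<close> is large enough that t = - b / D satisfies |t| \<le> 1 and that
    K / D < 1, which makes the value at \<open>t\<close> negative.\<close>
  define D where "D = 1 + \<bar>b\<bar> + \<bar>K\<bar>"
  have D: "D > 0" "\<bar>b\<bar> \<le> D" "K < D" using b by (auto simp: D_def)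
  define t where "t = - b / D"
  have "\<bar>t\<bar> \<le> 1" using D by (simp add: t_def abs_divide)
  then have "0 \<le> b * t + K * t\<^sup>2" by (rule assms)
  also have "\<dots> = (b\<^sup>2 / D) * (K / D - 1)"
    using D by (simp add: t_def power2_eq_square field_simps)
  also have "\<dots> < 0" using b D by (intro mult_pos_neg) auto
  finally show False by simp
qed

lemma inner_self_expand:
  fixes A B C :: "'f::real_inner"
  shows "(A + (2 * t) *\<^sub>R B + t\<^sup>2 *\<^sub>R C) \<bullet> (A + (2 * t) *\<^sub>R B + t\<^sup>2 *\<^sub>R C)
    = A \<bullet> A + 4 * t * (A \<bullet> B) + t\<^sup>2 * (4 * (B \<bullet> B) + 2 * (A \<bullet> C)) + 4 * t^3 * (B \<bullet> C) + t^4 * (C \<bullet> C)"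
  by (simp add: inner_simps inner_commute algebra_simps power2_eq_square power3_eq_cube power4_eq_xxxx)

text \<open>The unit vector \<open>x\<close> minimises \<open>norm (B x x)\<close>, which gives a first and a second order
  condition. The codimension hypothesis yields a nonzero \<open>y\<close> in the kernel of
  \<open>y \<mapsto> B x y + (L x \<bullet> L y) *\<^sub>R B x x\<close>, and the first order condition splits this single
  equation into \<open>L x \<bullet> L y = 0\<close> and \<open>B x y = 0\<close>.\<close>

lemma exists_small_normal_curvature:
  fixes L :: "'e::euclidean_space \<Rightarrow> 'f::euclidean_space" and B :: "'e \<Rightarrow> 'e \<Rightarrow> 'f"
  assumes L: "linear L" "\<And>w. L w = 0 \<Longrightarrow> w = 0"
    and B: "bilinear B" "\<And>x y. B x y = B y x" "\<And>x y z. B x y \<bullet> L z = 0"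
    and codim: "DIM('f) < 2 * DIM('e)"
    and c: "0 \<le> c"
    and curv: "\<And>x y. L x \<bullet> L x = 1 \<Longrightarrow> L y \<bullet> L y = 1 \<Longrightarrow> L x \<bullet> L y = 0 \<Longrightarrow>
      B x x \<bullet> B y y - B x y \<bullet> B x y \<le> c\<^sup>2"
  shows "\<exists>x. norm (L x) = 1 \<and> norm (B x x) \<le> c"
proof -
  interpret L: linear L by fact
  have injL: "inj L" using L by (simp add: linear_injective_0)
  interpret B: bounded_bilinear B using B(1) by (simp add: bilinear_conv_bounded_bilinear)
  \<comment> \<open>\<open>S\<close> is the unit sphere of the metric induced by \<open>L\<close>.
    It is compact because an injective linear map is bounded below.\<close>
  define S where "S = {x. norm (L x) = 1}"
  have contL: "continuous_on UNIV L" using L(1) by (rule linear_continuous_on_compose[OF continuous_on_id])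
  have "closed S" unfolding S_def
    using continuous_closed_vimage[of "{1}" "\<lambda>x. norm (L x)"] contL
    by (simp add: continuous_on_eq_continuous_at continuous_on_norm vimage_def)
  moreover have "bounded S"
  proof -
    obtain b where b: "b > 0" "\<And>x. b * norm x \<le> norm (L x)"
      using linear_inj_bounded_below_pos[OF L(1) injL] by blast
    have "norm x \<le> 1 / b" if "x \<in> S" for x
      using b(2)[of x] that b(1) by (simp add: S_def field_simps)
    then show ?thesis unfolding bounded_iff by blast
  qed
  ultimately have compact: "compact S" by (simp add: compact_eq_bounded_closed)
  have unit: "L (x /\<^sub>R norm (L x)) \<bullet> L (x /\<^sub>R norm (L x)) = 1" if "x \<noteq> 0" for x
  proof -
    have "L x \<noteq> 0" using L(2) that by auto
    then show ?thesis by (subst norm_eq_1[symmetric]) (simp add: L.scale)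
  qed
  have nonempty: "S \<noteq> {}"
  proof -
    obtain b :: 'e where "b \<in> Basis" using nonempty_Basis by blast
    then have "b /\<^sub>R norm (L b) \<in> S" using unit[of b] nonzero_Basis by (auto simp: S_def norm_eq_1)
    then show ?thesis by blast
  qed
  have "continuous_on S (\<lambda>x. norm (B x x))"
    by (intro continuous_on_norm B.continuous_on continuous_on_id)
  from continuous_attains_inf[OF compact nonempty this]
  obtain X where X: "X \<in> S" and min: "\<And>y. y \<in> S \<Longrightarrow> norm (B X X) \<le> norm (B y y)" by blast
  define A where "A = B X X"
  have LX: "L X \<bullet> L X = 1" using X by (simp add: S_def norm_eq_1)
  \<comment> \<open>Minimality on unit vectors, made homogeneous of degree four so that it can be
    tested at X + t Y without normalising.\<close>
  have hom: "A \<bullet> A * (L z \<bullet> L z)\<^sup>2 \<le> B z z \<bullet> B z z" for z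
  proof (cases "z = 0")
    case False
    let ?n = "norm (L z)"
    have n: "?n > 0" using False L(2) by auto
    have "norm A \<le> norm (B (z /\<^sub>R ?n) (z /\<^sub>R ?n))"
      unfolding A_def using unit[OF False] by (intro min) (simp add: S_def norm_eq_1)
    also have "\<dots> = norm (B z z) / ?n\<^sup>2"
      using n by (simp add: B.scaleR_left B.scaleR_right power2_eq_square field_simps)
    finally have "norm A * ?n\<^sup>2 \<le> norm (B z z)" using n by (simp add: field_simps)
    then have "(norm A * ?n\<^sup>2)\<^sup>2 \<le> (norm (B z z))\<^sup>2" by (intro power_mono) auto
    then show ?thesis by (simp add: power_mult_distrib power2_norm_eq_inner)
  qed (simp add: B.zero_left L.zero)
  have exp: "B (X + t *\<^sub>R Y) (X + t *\<^sub>R Y) = A + (2 * t) *\<^sub>R B X Y + t\<^sup>2 *\<^sub>R B Y Y" for t Y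
  proof -
    have "(2 * t) *\<^sub>R B X Y = t *\<^sub>R B X Y + t *\<^sub>R B X Y"
      by (simp add: scaleR_left_distrib[symmetric])
    then show ?thesis using B(2)[of Y X]
      by (simp add: A_def B.add_left B.add_right B.scaleR_left B.scaleR_right power2_eq_square scaleR_right_distrib)
  qed
  have expL: "L (X + t *\<^sub>R Y) \<bullet> L (X + t *\<^sub>R Y) = 1 + t\<^sup>2 * (L Y \<bullet> L Y)" if "L X \<bullet> L Y = 0" for t Y
    using that LX by (simp add: L.add L.scale inner_simps inner_commute power2_eq_square)
  \<comment> \<open>Minimality at X + t Y as a polynomial inequality in \<open>t\<close>, using (1 +
    s)^2 \<ge> 1 + 2 s. Its linear coefficient yields the first order condition; once that and
    \<open>B X Y\<close> vanish, the quadratic one yields the second order condition.\<close>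
  have ineq: "0 \<le> 4 * t * (A \<bullet> B X Y) + t\<^sup>2 * (4 * (B X Y \<bullet> B X Y) + 2 * (A \<bullet> B Y Y)) 
      + 4 * t^3 * (B X Y \<bullet> B Y Y) + t^4 * (B Y Y \<bullet> B Y Y) - 2 * t\<^sup>2 * (L Y \<bullet> L Y) * (A \<bullet> A)"
    if "L X \<bullet> L Y = 0" for t Y
  proof -
    have "A \<bullet> A * (1 + 2 * t\<^sup>2 * (L Y \<bullet> L Y)) \<le> A \<bullet> A * (1 + t\<^sup>2 * (L Y \<bullet> L Y))\<^sup>2"
      by (intro mult_left_mono) (auto simp: power2_sum)
    also have "\<dots> \<le> A \<bullet> A + 4 * t * (A \<bullet> B X Y) + t\<^sup>2 * (4 * (B X Y \<bullet> B X Y) + 2 * (A \<bullet> B Y Y)) 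
      + 4 * t^3 * (B X Y \<bullet> B Y Y) + t^4 * (B Y Y \<bullet> B Y Y)"
      using hom[of "X + t *\<^sub>R Y"] unfolding exp expL[OF that] inner_self_expand .
    finally show ?thesis by (simp add: algebra_simps)
  qed
  have first: "A \<bullet> B X Y = 0" if "L X \<bullet> L Y = 0" for Y
  proof -
    \<comment> \<open>For |t| \<le> 1 the cubic and quartic terms are dominated by multiples of t^2;
      \<open>K\<close> collects these multiples and the quadratic coefficient.\<close>
    define K where "K = \<bar>4 * (B X Y \<bullet> B X Y) + 2 * (A \<bullet> B Y Y)\<bar> + 4 * \<bar>B X Y \<bullet> B Y Y\<bar> + B Y Y \<bullet> B Y Y"
    have "0 \<le> 4 * (A \<bullet> B X Y) * t + K * t\<^sup>2" if t: "\<bar>t\<bar> \<le> 1" for t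
    proof -
      have t2: "t\<^sup>2 \<le> 1" using t by (simp add: abs_square_le_1)
      have "t\<^sup>2 * (4 * (B X Y \<bullet> B X Y) + 2 * (A \<bullet> B Y Y)) \<le> t\<^sup>2 * \<bar>4 * (B X Y \<bullet> B X Y) + 2 * (A \<bullet> B Y Y)\<bar>"
        by (intro mult_left_mono) auto
      moreover have "4 * t^3 * (B X Y \<bullet> B Y Y) \<le> t\<^sup>2 * (4 * \<bar>B X Y \<bullet> B Y Y\<bar>)"
      proof -
        have "t * (B X Y \<bullet> B Y Y) \<le> \<bar>t\<bar> * \<bar>B X Y \<bullet> B Y Y\<bar>" by (metis abs_ge_self abs_mult)
        also have "\<dots> \<le> 1 * \<bar>B X Y \<bullet> B Y Y\<bar>" using t by (intro mult_right_mono) auto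
        finally have "4 * t\<^sup>2 * (t * (B X Y \<bullet> B Y Y)) \<le> 4 * t\<^sup>2 * \<bar>B X Y \<bullet> B Y Y\<bar>"
          by (intro mult_left_mono) auto
        then show ?thesis by (simp add: power2_eq_square power3_eq_cube mult_ac)
      qed
      moreover have "t^4 * (B Y Y \<bullet> B Y Y) \<le> t\<^sup>2 * (B Y Y \<bullet> B Y Y)"
        using t2 mult_left_mono[OF t2, of "t\<^sup>2"] by (intro mult_right_mono) (auto simp: power4_eq_xxxx power2_eq_square mult_ac)
      moreover have "0 \<le> 2 * t\<^sup>2 * (L Y \<bullet> L Y) * (A \<bullet> A)" by simp
      moreover have "K * t\<^sup>2 = t\<^sup>2 * \<bar>4 * (B X Y \<bullet> B X Y) + 2 * (A \<bullet> B Y Y)\<bar>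
          + t\<^sup>2 * (4 * \<bar>B X Y \<bullet> B Y Y\<bar>) + t\<^sup>2 * (B Y Y \<bullet> B Y Y)"
        by (simp add: K_def algebra_simps)
      moreover have "4 * (A \<bullet> B X Y) * t = 4 * t * (A \<bullet> B X Y)" by simp
      ultimately show ?thesis using ineq[OF \<open>L X \<bullet> L Y = 0\<close>, of t] by linarith
    qed
    then have "4 * (A \<bullet> B X Y) = 0" by (rule linear_coeff_zero)
    then show ?thesis by simp
  qed
  have "norm A \<le> c"
  proof (cases "A = 0")
    case False
    define \<Phi> where "\<Phi> Y = B X Y + (L X \<bullet> L Y) *\<^sub>R A" for Y
    have lin: "linear \<Phi>"
      by (rule linearI) (simp_all add: \<Phi>_def B.add_right B.scaleR_right L.add L.scale inner_simps algebra_simps)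
    have "\<exists>Y. Y \<noteq> 0 \<and> \<Phi> Y = 0"
    proof (rule ccontr)
      assume no: "\<nexists>Y. Y \<noteq> 0 \<and> \<Phi> Y = 0"
      \<comment> \<open>The values of \<open>B\<close>, hence those of \<Phi>, are orthogonal to the
        range of \<open>L\<close>. If \<Phi> were injective, \<open>g\<close> would embed two copies
        of the domain into the codomain, against \<open>codim\<close>.\<close>
      define g where "g = (\<lambda>(y, z). \<Phi> y + L z)"
      have "linear g"
        unfolding g_def by (rule linearI) (auto simp: linear_add[OF lin] linear_scale[OF lin] L.add L.scale algebra_simps)
      moreover have "p = 0" if "g p = 0" for p
      proof -
        obtain y z where p: "p = (y, z)" by fastforce
        have "\<Phi> y + L z = 0" using that by (simp add: g_def p)
        then have "(\<Phi> y + L z) \<bullet> L z = 0" "(\<Phi> y + L z) \<bullet> \<Phi> y = 0" by auto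
        moreover have "\<Phi> y \<bullet> L z = 0" by (simp add: \<Phi>_def A_def inner_simps B(3))
        ultimately have "L z = 0" "\<Phi> y = 0" by (simp_all add: inner_simps inner_commute)
        then have "z = 0" "y = 0" using L(2) no by blast+
        then show ?thesis by (simp add: p zero_prod_def)
      qed
      ultimately have "dim (range g) = dim (UNIV :: ('e \<times> 'e) set)"
        by (intro dim_image_eq) (auto simp: linear_injective_0 intro: inj_on_subset)
      then have "2 * DIM('e) \<le> DIM('f)" using dim_subset_UNIV[of "range g"] by (simp add: dim_UNIV)
      then show False using codim by simp
    qed
    then obtain Y0 where Y0: "Y0 \<noteq> 0" "\<Phi> Y0 = 0" by blast
    define Y where "Y = Y0 /\<^sub>R norm (L Y0)"
    have LY: "L Y \<bullet> L Y = 1" using unit[OF Y0(1)] by (simp add: Y_def)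
    have "\<Phi> Y = 0" using linear_scale[OF lin] Y0(2) by (simp add: Y_def)
    have perp: "L X \<bullet> L Y = 0"
    proof -
      \<comment> \<open>\<open>Y'\<close> is the part of \<open>Y\<close> orthogonal to
        \<open>X\<close>. The first order condition for it says that the inner product of
        \<open>A\<close> and \<open>B X Y\<close> is the coefficient
        \<open>L X \<bullet> L Y\<close> times |A|^2, while \<Phi> Y = 0 gives the same with the
        opposite sign. The plus sign in \<Phi> produces this clash.\<close>
      define Y' where "Y' = Y - (L X \<bullet> L Y) *\<^sub>R X"
      have "L X \<bullet> L Y' = 0" using LX by (simp add: Y'_def L.diff L.scale inner_simps)
      from first[OF this] have "A \<bullet> B X Y = (L X \<bullet> L Y) * (A \<bullet> A)"
        by (simp add: Y'_def B.diff_right B.scaleR_right inner_simps A_def)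
      moreover have "A \<bullet> \<Phi> Y = 0" using \<open>\<Phi> Y = 0\<close> by simp
      moreover have "A \<bullet> \<Phi> Y = A \<bullet> B X Y + (L X \<bullet> L Y) * (A \<bullet> A)" by (simp add: \<Phi>_def inner_simps)
      ultimately have "(L X \<bullet> L Y) * (A \<bullet> A) = 0" by linarith
      then show ?thesis using False by auto
    qed
    then have BXY: "B X Y = 0" using \<open>\<Phi> Y = 0\<close> by (simp add: \<Phi>_def)
    have "A \<bullet> A \<le> A \<bullet> B Y Y"
    proof (rule ccontr)
      assume neg: "\<not> A \<bullet> A \<le> A \<bullet> B Y Y"
      define D E where "D = A \<bullet> A - A \<bullet> B Y Y" and "E = B Y Y \<bullet> B Y Y"
      have DE: "D > 0" "E \<ge> 0" using neg by (auto simp: D_def E_def)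
      \<comment> \<open>Since \<open>B X Y = 0\<close>, the odd terms of \<open>ineq\<close> vanish,
        and for t = sqrt s it reads 0 \<le> s (s E - 2 D). The choice of \<open>s\<close> makes s E
        < 2 D.\<close>
      define s where "s = D / (1 + E)"
      have s: "s > 0" "s * E < 2 * D" using DE by (auto simp: s_def field_simps add_pos_nonneg intro!: add_nonneg_pos)
      have "0 \<le> (sqrt s)\<^sup>2 * (2 * (A \<bullet> B Y Y)) + (sqrt s)^4 * E - 2 * (sqrt s)\<^sup>2 * (A \<bullet> A)"
        using ineq[OF perp, of "sqrt s"] by (simp add: BXY LY E_def)
      moreover have "(sqrt s)^4 = s\<^sup>2" using s(1) power_mult[of "sqrt s" 2 2] by simp
      ultimately have "0 \<le> s * (s * E - 2 * D)"
        using s(1) by (simp add: D_def power2_eq_square algebra_simps)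
      then show False using s by (simp add: zero_le_mult_iff)
    qed
    also have "\<dots> \<le> c\<^sup>2" using curv[OF LX LY perp] by (simp add: A_def BXY)
    finally have "(norm A)\<^sup>2 \<le> c\<^sup>2" by (simp add: power2_norm_eq_inner)
    then show ?thesis using c by (rule power2_le_imp_le)
  qed (use c in simp)
  then show ?thesis using X by (auto simp: A_def S_def)
qed

section \<open>Isometric immersions in coordinates\<close>

lemma is_chart_inj_on:
  assumes "is_chart X c"
  shows "inj_on (coord c) (chart_dom c)"
proof -
  have "topspace (subtopology X (chart_dom c)) = chart_dom c"
    using assms openin_subset unfolding is_chart_def topspace_subtopology by blast
  then show ?thesis
    using assms homeomorphic_imp_injective_map unfolding is_chart_def by metis
qed

lemma coord_inv_coord: "is_chart X c \<Longrightarrow> x \<in> chart_dom c \<Longrightarrow> coord_inv c (coord c x) = x"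
  unfolding coord_inv_def by (simp add: is_chart_inj_on)

lemma is_chart_open: "is_chart X c \<Longrightarrow> open (coord c ` chart_dom c)"
  by (simp add: is_chart_def)

lemma is_chart_open_Int:
  assumes c: "is_chart X c" and d: "is_chart X d"
  shows "open (coord c ` (chart_dom c \<inter> chart_dom d))"
proof -
  have "openin (subtopology X (chart_dom c)) (chart_dom c \<inter> chart_dom d)"
    using d unfolding is_chart_def by (metis inf_commute openin_subtopology_Int)
  then have "openin (top_of_set (coord c ` chart_dom c)) (coord c ` (chart_dom c \<inter> chart_dom d))"
    using c homeomorphic_imp_open_map unfolding is_chart_def open_map_def by metis
  then show ?thesis using is_chart_open[OF c] openin_open_eq by blast
qed

section \<open>Tangent vectors and their components in charts\<close>

locale riemannian =
  fixes M :: "('a, 'm::finite) rmanifold"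
  assumes riem: "riemannian_manifold M"
begin

lemma smooth_mfd: "smooth_manifold M"
  using riem by (simp add: riemannian_manifold_def)

lemma chart: "c \<in> charts_at M x \<Longrightarrow> is_chart (mtop M) c"
  using smooth_mfd by (simp add: smooth_manifold_def charts_at_def)

lemma charts_at_coord:
  assumes "c \<in> charts_at M x"
  shows "coord c x \<in> coord c ` chart_dom c" "open (coord c ` chart_dom c)" "x \<in> chart_dom c"
    "coord_inv c (coord c x) = x" "c \<in> atlas M" "x \<in> topspace (mtop M)"
proof -
  show x: "x \<in> chart_dom c" and c: "c \<in> atlas M" using assms by (simp_all add: charts_at_def)
  show "coord c x \<in> coord c ` chart_dom c" using x by (rule imageI)
  show "open (coord c ` chart_dom c)" by (rule is_chart_open[OF chart[OF assms]])
  show "coord_inv c (coord c x) = x" by (rule coord_inv_coord[OF chart[OF assms] x])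
  show "x \<in> topspace (mtop M)" using smooth_mfd x c unfolding smooth_manifold_def by blast
qed

lemma charts_at_move:
  assumes "c \<in> charts_at M x" "q \<in> coord c ` chart_dom c"
  shows "c \<in> charts_at M (coord_inv c q)" "coord c (coord_inv c q) = q"
  using assms coord_inv_coord[OF chart[OF assms(1)]] by (auto simp: charts_at_def)

lemma chart_at_in:
  assumes "x \<in> topspace (mtop M)"
  shows "chart_at M x \<in> charts_at M x"
proof -
  have "\<exists>c. c \<in> charts_at M x"
    using assms smooth_mfd unfolding smooth_manifold_def charts_at_def by blast
  then show ?thesis unfolding chart_at_def by (rule someI_ex)
qed

lemma transition_differentiable:
  assumes c: "c \<in> charts_at M x" and d: "d \<in> charts_at M x"
  shows "(coord d \<circ> coord_inv c) differentiable (at (coord c x))"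
proof -
  have "smooth_on (coord c ` (chart_dom c \<inter> chart_dom d)) (coord d \<circ> coord_inv c)"
    using smooth_mfd c d by (auto simp: smooth_manifold_def charts_at_def compatible_def)
  from smooth_on_has_derivative[OF this, of "coord c x"] show ?thesis
    using c d by (auto simp: charts_at_def differentiable_def)
qed

text \<open>Chain rule through the transition map. The factorisation of \<open>F\<close> holds only
  on the chart overlap, whose openness suffices for derivatives.\<close>

lemma frechet_derivative_change_chart:
  assumes c: "c \<in> charts_at M x" and d: "d \<in> charts_at M x"
    and F: "(F \<circ> coord_inv d) differentiable (at (coord d x))"
  shows "frechet_derivative (F \<circ> coord_inv c) (at (coord c x)) w =
    frechet_derivative (F \<circ> coord_inv d) (at (coord d x))
      (frechet_derivative (coord d \<circ> coord_inv c) (at (coord c x)) w)"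
proof -
  let ?S = "coord c ` (chart_dom c \<inter> chart_dom d)"
  have "frechet_derivative (F \<circ> coord_inv c) (at (coord c x)) =
    frechet_derivative ((F \<circ> coord_inv d) \<circ> (coord d \<circ> coord_inv c)) (at (coord c x))"
  proof (rule frechet_derivative_cong)
    show "open ?S" using is_chart_open_Int chart c d by blast
    show "coord c x \<in> ?S" using c d by (auto simp: charts_at_def)
    show "(F \<circ> coord_inv c) y = ((F \<circ> coord_inv d) \<circ> (coord d \<circ> coord_inv c)) y" if "y \<in> ?S" for y
      using that coord_inv_coord[OF chart[OF c]] coord_inv_coord[OF chart[OF d]] by auto
  qed
  also have "\<dots> = frechet_derivative (F \<circ> coord_inv d) (at ((coord d \<circ> coord_inv c) (coord c x)))
      \<circ> frechet_derivative (coord d \<circ> coord_inv c) (at (coord c x))"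
    by (rule frechet_derivative_compose[OF transition_differentiable[OF c d]])
      (simp add: charts_at_coord[OF c] F)
  finally show ?thesis by (simp add: charts_at_coord[OF c])
qed

text \<open>Inverse to reading off components in \<open>c\<close>: it identifies coordinate vectors
  with tangent vectors at \<open>x\<close>. The value 0 elsewhere is the normalisation demanded by
  \<open>tangent_space\<close>.\<close>

definition tvec_of :: "('a, 'm) chart \<Rightarrow> 'a \<Rightarrow> real ^ 'm \<Rightarrow> ('a, 'm) tvec" where
  "tvec_of c x w = (\<lambda>d. if d \<in> charts_at M x
     then frechet_derivative (coord d \<circ> coord_inv c) (at (coord c x)) w else 0)"

lemma coord_vec_eq: "coord_vec M c i x = tvec_of c x (axis i 1)"
  by (simp add: coord_vec_def tvec_of_def)

lemma tvec_of_tangent: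
  assumes c: "c \<in> charts_at M x"
  shows "tvec_of c x w \<in> tangent_space M x"
proof -
  have "tvec_of c x w e = frechet_derivative (coord e \<circ> coord_inv d) (at (coord d x)) (tvec_of c x w d)"
    if d: "d \<in> charts_at M x" and e: "e \<in> charts_at M x" for d e
    using frechet_derivative_change_chart[OF c d transition_differentiable[OF d e], of w] d e
    by (simp add: tvec_of_def)
  moreover have "tvec_of c x w e = 0" if "e \<notin> charts_at M x" for e
    using that by (simp add: tvec_of_def)
  ultimately show ?thesis unfolding tangent_space_def by blast
qed

lemma tvec_of_self:
  assumes c: "c \<in> charts_at M x"
  shows "tvec_of c x w c = w"
proof -
  have "frechet_derivative (coord c \<circ> coord_inv c) (at (coord c x)) = frechet_derivative (\<lambda>y. y) (at (coord c x))"
    by (rule frechet_derivative_cong[OF charts_at_coord(2,1)[OF c]])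
      (simp add: charts_at_move[OF c])
  then show ?thesis using c by (simp add: tvec_of_def)
qed

end

section \<open>Metric, connection and curvature of an immersed manifold in a chart\<close>

locale isometrically_immersed = riemannian M for M :: "('a, 'm::finite) rmanifold" +
  fixes \<phi> :: "'a \<Rightarrow> 'f::euclidean_space"
  assumes imm: "isometric_immersion M \<phi>"
begin

lemma smooth_on_chart:
  assumes "c \<in> atlas M"
  shows "smooth_on (coord c ` chart_dom c) (\<phi> \<circ> coord_inv c)"
  using imm assms by (simp add: isometric_immersion_def immersion_def smooth_map_def Ck_manifold_def smooth_on_def)

lemma differentiable_chart:
  assumes c: "c \<in> charts_at M x"
  shows "(\<phi> \<circ> coord_inv c) differentiable (at (coord c x))"
  using smooth_on_has_derivative[OF smooth_on_chart charts_at_coord(1)[OF c]] charts_at_coord(5)[OF c]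
  by (auto simp: differentiable_def)

lemma differential_tvec_of:
  assumes c: "c \<in> charts_at M x"
  shows "differential M \<phi> x (tvec_of c x w) = frechet_derivative (\<phi> \<circ> coord_inv c) (at (coord c x)) w"
proof -
  have d: "chart_at M x \<in> charts_at M x" using chart_at_in charts_at_coord(6)[OF c] .
  show ?thesis
    unfolding differential_def Let_def
    using frechet_derivative_change_chart[OF c d differentiable_chart[OF d]] d
    by (simp add: tvec_of_def)
qed

lemma metric_tvec_of:
  assumes c: "c \<in> charts_at M x"
  shows "metric M x (tvec_of c x w) (tvec_of c x z) =
    frechet_derivative (\<phi> \<circ> coord_inv c) (at (coord c x)) w \<bullet> frechet_derivative (\<phi> \<circ> coord_inv c) (at (coord c x)) z"
  using imm tvec_of_tangent[OF c] charts_at_coord(6)[OF c]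
  by (simp add: isometric_immersion_def differential_tvec_of[OF c])

lemma metric_coeff_eq:
  assumes c: "c \<in> charts_at M x"
  shows "metric_coeff M c i j x = pd i (\<phi> \<circ> coord_inv c) (coord c x) \<bullet> pd j (\<phi> \<circ> coord_inv c) (coord c x)"
  by (simp add: metric_coeff_def coord_vec_eq metric_tvec_of[OF c] pd_def)

text \<open>A kernel vector \<open>w\<close> of the coordinate derivative makes
  \<open>tvec_of c x w\<close> and \<open>tvec_of c x 0\<close> have equal differentials, so
  injectivity on the tangent space gives w = 0.\<close>

lemma local_immersion_chart:
  assumes "c \<in> atlas M"
  shows "local_immersion (\<phi> \<circ> coord_inv c) (coord c ` chart_dom c)"
proof
  show "open (coord c ` chart_dom c)"
    using assms smooth_mfd is_chart_open unfolding smooth_manifold_def by blast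
  show "smooth_on (coord c ` chart_dom c) (\<phi> \<circ> coord_inv c)"
    by (rule smooth_on_chart[OF assms])
  fix q w assume q: "q \<in> coord c ` chart_dom c"
    and 0: "frechet_derivative (\<phi> \<circ> coord_inv c) (at q) w = 0"
  then obtain x where x: "x \<in> chart_dom c" "q = coord c x" by blast
  have c: "c \<in> charts_at M x" using assms x by (simp add: charts_at_def)
  have "differential M \<phi> x (tvec_of c x w) = differential M \<phi> x (tvec_of c x 0)"
    using 0 linear_0[OF linear_frechet_derivative[OF differentiable_chart[OF c]]]
    by (simp add: differential_tvec_of[OF c] x)
  then have "tvec_of c x w = tvec_of c x 0"
    using imm tvec_of_tangent[OF c] charts_at_coord(6)[OF c]
    unfolding isometric_immersion_def immersion_def inj_on_def by blast
  then show "w = 0" using tvec_of_self[OF c] by metis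
qed

text \<open>Transfers derivatives on the manifold to \<open>pd\<close>; agreement on the chart
  domain is enough because derivatives are local.\<close>

lemma chart_partial_eq:
  assumes c: "c \<in> charts_at M x"
    and "\<And>y. c \<in> charts_at M y \<Longrightarrow> F y = G (coord c y)"
  shows "chart_partial c i F x = pd i G (coord c x)"
  unfolding chart_partial_def pd_def[symmetric]
  by (rule pd_cong[OF charts_at_coord(2,1)[OF c]]) (simp add: assms(2) charts_at_move[OF c])

text \<open>The three metric derivatives expand into six products of first and second derivatives of
  the immersion. By symmetry four of them cancel and the other two agree, which absorbs the factor
  1/2.\<close>

lemma christoffel_eq:
  assumes c: "c \<in> charts_at M x"
  shows "christoffel M c k i j x = gamma (\<phi> \<circ> coord_inv c) k i j (coord c x)"
proof -
  define f where "f = \<phi> \<circ> coord_inv c"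
  define U where "U = coord c ` chart_dom c"
  interpret local_immersion f U
    unfolding f_def U_def by (rule local_immersion_chart[OF charts_at_coord(5)[OF c]])
  have xU: "coord c x \<in> U" unfolding U_def by (rule charts_at_coord(1)[OF c])
  have g: "chart_partial c i (metric_coeff M c j l) x =
      pd j f (coord c x) \<bullet> pd i (pd l f) (coord c x) + pd i (pd j f) (coord c x) \<bullet> pd l f (coord c x)" for i j l
    using chart_partial_eq[OF c, of "metric_coeff M c j l" "\<lambda>q. pd j f q \<bullet> pd l f q" i] metric_coeff_eq
    by (simp add: f_def[symmetric] pd_inner pd_differentiable xU)
  have "(\<chi> i j. metric_coeff M c i j x) = gram f (coord c x)"
    by (simp add: gram_def metric_coeff_eq[OF c] f_def)
  moreover have "chart_partial c i (metric_coeff M c j l) x + chart_partial c j (metric_coeff M c i l) x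
      - chart_partial c l (metric_coeff M c i j) x = 2 * (pd i (pd j f) (coord c x) \<bullet> pd l f (coord c x))" for l
    unfolding g using pd_pd_commute[OF xU, of i l] pd_pd_commute[OF xU, of j l] pd_pd_commute[OF xU, of j i]
    by (simp add: inner_commute)
  ultimately show ?thesis
    unfolding christoffel_def gamma_def metric_inv_coeff_def f_def[symmetric]
    by (simp add: sum_divide_distrib)
qed

lemma riemann_coeff_eq:
  assumes c: "c \<in> charts_at M x"
  shows "riemann_coeff M c l i j k x = curv_coeff (\<phi> \<circ> coord_inv c) l i j k (coord c x)"
proof -
  have "chart_partial c i (christoffel M c l j k) x = pd i (gamma (\<phi> \<circ> coord_inv c) l j k) (coord c x)" for i j
    by (rule chart_partial_eq[OF c]) (rule christoffel_eq)
  then show ?thesis by (simp add: riemann_coeff_def curv_coeff_def christoffel_eq[OF c])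
qed

text \<open>Vectors enter through their components in \<open>c\<close>, so that the algebraic lemma
  can be applied on coordinate space.\<close>

definition second_form :: "('a, 'm) chart \<Rightarrow> 'a \<Rightarrow> real ^ 'm \<Rightarrow> real ^ 'm \<Rightarrow> 'f" where
  "second_form c x X Y = (\<Sum>i\<in>UNIV. X $ i *\<^sub>R (\<Sum>j\<in>UNIV. Y $ j *\<^sub>R sff (\<phi> \<circ> coord_inv c) i j (coord c x)))"

lemma bilinear_second_form: "bilinear (second_form c x)"
  unfolding bilinear_def second_form_def
  by (auto intro!: linearI simp: scaleR_left_distrib scaleR_right_distrib sum.distrib scaleR_sum_right distrib_left distrib_right mult_ac)

lemma hessian_eq:
  assumes x: "x \<in> topspace (mtop M)" and c: "c = chart_at M x"
    and h: "\<And>y. c \<in> charts_at M y \<Longrightarrow> u y = h (coord c y)"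
  shows "hessian M u x V W = (\<Sum>i\<in>UNIV. \<Sum>j\<in>UNIV. V c $ i * W c $ j *
    (pd i (pd j h) (coord c x) - (\<Sum>k\<in>UNIV. gamma (\<phi> \<circ> coord_inv c) k i j (coord c x) * pd k h (coord c x))))"
proof -
  have cx: "c \<in> charts_at M x" using chart_at_in[OF x] c by simp
  have "chart_partial c j u y = pd j h (coord c y)" if "c \<in> charts_at M y" for j y
    using chart_partial_eq[OF that, of u h] h by blast
  then show ?thesis
    unfolding hessian_def Let_def c[symmetric]
    by (simp add: christoffel_eq[OF cx] chart_partial_eq[OF cx, where G = "pd _ h"] cx)
qed

text \<open>The Gauss equation contracted with components: the sum over \<open>l\<close> is moved
  innermost, where \<open>gauss_equation\<close> evaluates it, and the other sums are then folded
  into \<open>second_form\<close>.\<close>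

lemma riemann4_eq:
  assumes x: "x \<in> topspace (mtop M)" and c: "c = chart_at M x"
  shows "riemann4 M x (tvec_of c x X) (tvec_of c x Y) (tvec_of c x Y) (tvec_of c x X) =
     second_form c x Y Y \<bullet> second_form c x X X - second_form c x X Y \<bullet> second_form c x Y X"
proof -
  have cx: "c \<in> charts_at M x" using chart_at_in[OF x] c by simp
  define f where "f = \<phi> \<circ> coord_inv c"
  define q where "q = coord c x"
  interpret local_immersion f "coord c ` chart_dom c"
    unfolding f_def by (rule local_immersion_chart[OF charts_at_coord(5)[OF cx]])
  have qU: "q \<in> coord c ` chart_dom c" unfolding q_def by (rule charts_at_coord(1)[OF cx])
  define S where "S i j = sff f i j q" for i j
  define N where "N i = (\<Sum>j\<in>UNIV. X $ j *\<^sub>R S i j)" for i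
  define P where "P i = (\<Sum>j\<in>UNIV. Y $ j *\<^sub>R S i j)" for i
  have "riemann4 M x (tvec_of c x X) (tvec_of c x Y) (tvec_of c x Y) (tvec_of c x X) =
     (\<Sum>i\<in>UNIV. \<Sum>j\<in>UNIV. \<Sum>k\<in>UNIV. \<Sum>l\<in>UNIV. \<Sum>r\<in>UNIV.
       X $ i * Y $ j * Y $ k * X $ r * curv_coeff f l i j k q * (pd l f q \<bullet> pd r f q))"
    unfolding riemann4_def Let_def c[symmetric] tvec_of_self[OF cx]
    by (simp add: riemann_coeff_eq[OF cx] metric_coeff_eq[OF cx] f_def q_def)
  also have "\<dots> = (\<Sum>i\<in>UNIV. \<Sum>j\<in>UNIV. \<Sum>k\<in>UNIV. \<Sum>r\<in>UNIV.
       X $ i * Y $ j * Y $ k * X $ r * (\<Sum>l\<in>UNIV. curv_coeff f l i j k q * (pd l f q \<bullet> pd r f q)))"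
    by (subst sum.swap[where A = "UNIV :: 'm set" and B = "UNIV :: 'm set"]) (simp add: sum_distrib_left mult.assoc)
  also have "\<dots> = (\<Sum>i\<in>UNIV. \<Sum>j\<in>UNIV. \<Sum>k\<in>UNIV. \<Sum>r\<in>UNIV.
       X $ i * Y $ j * Y $ k * X $ r * (S j k \<bullet> S i r - S i k \<bullet> S j r))"
    by (simp add: gauss_equation[OF qU] S_def)
  also have "\<dots> = (\<Sum>i\<in>UNIV. \<Sum>j\<in>UNIV. \<Sum>k\<in>UNIV. X $ i * Y $ j * Y $ k * (S j k \<bullet> N i - S i k \<bullet> N j))"
    by (simp add: N_def inner_sum_right sum_distrib_left sum_subtractf right_diff_distrib mult_ac)
  also have "\<dots> = (\<Sum>i\<in>UNIV. \<Sum>j\<in>UNIV. X $ i * Y $ j * (P j \<bullet> N i - P i \<bullet> N j))"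
    by (simp add: P_def inner_sum_left sum_distrib_left sum_subtractf right_diff_distrib mult_ac)
  also have "\<dots> = (\<Sum>i\<in>UNIV. \<Sum>j\<in>UNIV. X $ i * Y $ j * (P j \<bullet> N i)) - (\<Sum>i\<in>UNIV. \<Sum>j\<in>UNIV. X $ i * Y $ j * (P i \<bullet> N j))"
    by (simp add: sum_subtractf right_diff_distrib)
  also have "(\<Sum>i\<in>UNIV. \<Sum>j\<in>UNIV. X $ i * Y $ j * (P j \<bullet> N i)) =
      (\<Sum>j\<in>UNIV. Y $ j *\<^sub>R P j) \<bullet> (\<Sum>i\<in>UNIV. X $ i *\<^sub>R N i)"
    unfolding inner_sum_right unfolding inner_sum_left by (simp add: mult_ac)
  also have "(\<Sum>i\<in>UNIV. \<Sum>j\<in>UNIV. X $ i * Y $ j * (P i \<bullet> N j)) =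
      (\<Sum>i\<in>UNIV. X $ i *\<^sub>R P i) \<bullet> (\<Sum>j\<in>UNIV. Y $ j *\<^sub>R N j)"
    unfolding inner_sum_left unfolding inner_sum_right by (simp add: mult_ac)
  finally show ?thesis
    by (simp add: second_form_def P_def N_def S_def f_def q_def)
qed

text \<open>The algebraic lemma with \<open>L\<close> the derivative of the immersion and
  \<open>B\<close> the second fundamental form. On an orthonormal pair the denominator of
  \<open>sect_curv\<close> is 1, so the Gauss equation turns the curvature bound into the bound
  required of \<open>B\<close>.\<close>

lemma exists_small_second_form:
  assumes x: "x \<in> topspace (mtop M)" and c: "c = chart_at M x"
    and codim: "DIM('f) < 2 * CARD('m)" and chi: "0 \<le> \<kappa>"
    and sect: "\<And>w z. w \<in> tangent_space M x \<Longrightarrow> z \<in> tangent_space M x \<Longrightarrow> tindep w z \<Longrightarrow>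
      sect_curv M x w z \<le> \<kappa>\<^sup>2"
  shows "\<exists>X. norm (frechet_derivative (\<phi> \<circ> coord_inv c) (at (coord c x)) X) = 1 \<and>
    norm (second_form c x X X) \<le> \<kappa>"
proof (rule exists_small_normal_curvature[where L = "frechet_derivative (\<phi> \<circ> coord_inv c) (at (coord c x))" and B = "second_form c x"])
  have cx: "c \<in> charts_at M x" using chart_at_in[OF x] c by simp
  let ?L = "frechet_derivative (\<phi> \<circ> coord_inv c) (at (coord c x))"
  interpret local_immersion "\<phi> \<circ> coord_inv c" "coord c ` chart_dom c"
    by (rule local_immersion_chart[OF charts_at_coord(5)[OF cx]])
  have xU: "coord c x \<in> coord c ` chart_dom c" by (rule charts_at_coord(1)[OF cx])
  show lin: "linear ?L" by (rule linear_frechet_derivative[OF differentiable_chart[OF cx]])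
  show "w = 0" if "?L w = 0" for w using inj[OF xU that] .
  show "bilinear (second_form c x)" by (rule bilinear_second_form)
  show sym: "second_form c x X Y = second_form c x Y X" for X Y
    unfolding second_form_def scaleR_sum_right
    by (subst sum.swap) (simp add: sff_sym[OF xU] mult.commute)
  show "second_form c x X Y \<bullet> ?L Z = 0" for X Y Z
    by (simp add: second_form_def inner_sum_left sff_normal'[OF xU])
  show "DIM('f) < 2 * DIM(real ^ 'm)" using codim by simp
  show "second_form c x X X \<bullet> second_form c x Y Y - second_form c x X Y \<bullet> second_form c x X Y \<le> \<kappa>\<^sup>2"
    if "?L X \<bullet> ?L X = 1" "?L Y \<bullet> ?L Y = 1" "?L X \<bullet> ?L Y = 0" for X Y
  proof -
    let ?V = "tvec_of c x X" and ?W = "tvec_of c x Y"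
    have "tindep ?V ?W"
      unfolding tindep_def
    proof (intro allI impI)
      fix a b assume "tcomb a ?V b ?W = tzero"
      then have "tcomb a ?V b ?W c = tzero c" by simp
      then have "a *\<^sub>R X + b *\<^sub>R Y = 0" by (simp add: tcomb_def tzero_def tvec_of_self[OF cx])
      then have "?L (a *\<^sub>R X + b *\<^sub>R Y) = 0" using linear_0[OF lin] by simp
      then have 0: "a *\<^sub>R ?L X + b *\<^sub>R ?L Y = 0"
        unfolding linear_add[OF lin] linear_scale[OF lin] .
      have 1: "(a *\<^sub>R ?L X + b *\<^sub>R ?L Y) \<bullet> ?L X = a" "(a *\<^sub>R ?L X + b *\<^sub>R ?L Y) \<bullet> ?L Y = b"
        using that by (simp_all add: inner_add_left inner_commute[of "?L Y" "?L X"])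
      show "a = 0 \<and> b = 0" using 1[unfolded 0] by simp
    qed
    from sect[OF tvec_of_tangent[OF cx] tvec_of_tangent[OF cx] this]
    have "sect_curv M x ?V ?W \<le> \<kappa>\<^sup>2" .
    moreover have "metric M x ?V ?V * metric M x ?W ?W - (metric M x ?V ?W)\<^sup>2 = 1"
      unfolding metric_tvec_of[OF cx] that by simp
    moreover have "riemann4 M x ?V ?W ?W ?V
      = second_form c x X X \<bullet> second_form c x Y Y - second_form c x X Y \<bullet> second_form c x X Y"
      unfolding riemann4_eq[OF x c] sym[of Y X] by (simp only: inner_commute)
    ultimately show ?thesis unfolding sect_curv_def by (simp only: div_by_1)
  qed
qed (rule chi)

end

section \<open>The test function\<close>

definition cone_fun :: "real \<Rightarrow> real \<Rightarrow> 'f::real_inner \<Rightarrow> 'f \<Rightarrow> 'f \<Rightarrow> real" where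
  "cone_fun T a p v z = sqrt (T\<^sup>2 + a\<^sup>2 * ((z - p) \<bullet> (z - p))) - (z - p) \<bullet> v"

text \<open>Reciprocal of the square root in \<open>cone_fun\<close>. The first and second
  derivatives of \<open>cone_fun\<close> are polynomial in it.\<close>

definition cone_inv_rad :: "real \<Rightarrow> real \<Rightarrow> 'f::real_inner \<Rightarrow> 'f \<Rightarrow> real" where
  "cone_inv_rad T a p z = inverse (sqrt (T\<^sup>2 + a\<^sup>2 * ((z - p) \<bullet> (z - p))))"

lemma cone_radicand_pos: "T > 0 \<Longrightarrow> T\<^sup>2 + a\<^sup>2 * ((z - p) \<bullet> (z - p)) > 0" for p z :: "'f::real_inner"
  by (simp add: add_pos_nonneg)

text \<open>T > 0 keeps the radicand positive, so the square root stays smooth even where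
  \<open>f q = p\<close>.\<close>

lemma Ck_on_cone_fun:
  fixes f :: "'e::euclidean_space \<Rightarrow> 'f::real_inner"
  assumes "open U" "Ck_on k U f" "T > 0"
  shows "Ck_on k U (\<lambda>q. cone_fun T a p v (f q))"
  unfolding cone_fun_def using cone_radicand_pos[OF assms(3)]
  by (intro Ck_on_diff Ck_on_sqrt Ck_on_add Ck_on_mult Ck_on_inner Ck_on_const assms(1,2)) auto

context
  fixes f :: "real ^ 'm::finite \<Rightarrow> 'f::real_inner" and q D and T a :: real and p v :: 'f
  assumes D: "(f has_derivative D) (at q)" and T: "T > 0"
begin

private lemma der_sqrt:
  "((\<lambda>q. sqrt (T\<^sup>2 + a\<^sup>2 * ((f q - p) \<bullet> (f q - p)))) has_derivative
     (\<lambda>w. a\<^sup>2 * cone_inv_rad T a p (f q) * (D w \<bullet> (f q - p)))) (at q)"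
proof -
  have "((\<lambda>q. T\<^sup>2 + a\<^sup>2 * ((f q - p) \<bullet> (f q - p))) has_derivative (\<lambda>w. a\<^sup>2 * (2 * (D w \<bullet> (f q - p))))) (at q)"
    by (auto intro!: derivative_eq_intros D simp: inner_commute)
  from has_derivative_real_sqrt[OF cone_radicand_pos[OF T] this]
  show ?thesis by (simp add: cone_inv_rad_def mult_ac)
qed

lemma has_derivative_cone_fun:
  "((\<lambda>q. cone_fun T a p v (f q)) has_derivative
     (\<lambda>w. D w \<bullet> ((a\<^sup>2 * cone_inv_rad T a p (f q)) *\<^sub>R (f q - p) - v))) (at q)"
proof -
  have "((\<lambda>q. (f q - p) \<bullet> v) has_derivative (\<lambda>w. D w \<bullet> v)) (at q)"
    by (auto intro!: derivative_eq_intros D)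
  from has_derivative_diff[OF der_sqrt this] show ?thesis
    by (simp add: cone_fun_def inner_diff_right)
qed

lemma has_derivative_cone_rad:
  "((\<lambda>q. cone_inv_rad T a p (f q)) has_derivative
     (\<lambda>w. - (a\<^sup>2 * cone_inv_rad T a p (f q) ^ 3 * (D w \<bullet> (f q - p))))) (at q)"
proof -
  have "sqrt (T\<^sup>2 + a\<^sup>2 * ((f q - p) \<bullet> (f q - p))) \<noteq> 0"
    using cone_radicand_pos[OF T, of a "f q" p] by simp
  from Deriv.has_derivative_inverse[OF this der_sqrt] show ?thesis
    unfolding cone_inv_rad_def[symmetric] by (simp add: power3_eq_cube mult_ac)
qed

end

text \<open>The Euclidean gradient of \<open>cone_fun\<close> in \<open>z\<close>, by
  \<open>has_derivative_cone_fun\<close>.\<close>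

definition cone_grad :: "real \<Rightarrow> real \<Rightarrow> 'f::real_inner \<Rightarrow> 'f \<Rightarrow> 'f \<Rightarrow> 'f" where
  "cone_grad T a p v z = (a\<^sup>2 * cone_inv_rad T a p z) *\<^sub>R (z - p) - v"

lemma cone_inv_rad_sq:
  fixes p z :: "'f::real_inner"
  assumes "T > 0"
  shows "(cone_inv_rad T a p z)\<^sup>2 * (T\<^sup>2 + a\<^sup>2 * ((z - p) \<bullet> (z - p))) = 1" "cone_inv_rad T a p z > 0"
  using cone_radicand_pos[OF assms, of a z p] by (simp_all add: cone_inv_rad_def power_inverse)

text \<open>With w = z - p and s = \<open>a\<^sup>2 * R\<close>, the squared norm is 1 + s (s |w|^2
  - 2 h), where \<open>h\<close> is the height of \<open>w\<close> along \<open>v\<close>. Since R a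
  |w| \<le> 1, the cone condition gives s |w|^2 \<le> a |w| \<le> h, so the bracket is not
  positive.\<close>

lemma norm_cone_grad_le:
  fixes p v z :: "'f::real_inner"
  assumes v: "norm v = 1" and T: "T > 0" and a: "a \<ge> 0" and z: "a * norm (z - p) \<le> (z - p) \<bullet> v"
  shows "norm (cone_grad T a p v z) \<le> 1"
proof -
  define R r where "R = cone_inv_rad T a p z" and "r = norm (z - p)"
  have r: "(z - p) \<bullet> (z - p) = r\<^sup>2" "r \<ge> 0" by (simp_all add: r_def power2_norm_eq_inner)
  have R: "R\<^sup>2 * (T\<^sup>2 + a\<^sup>2 * r\<^sup>2) = 1" "R > 0"
    using cone_inv_rad_sq[OF T, of a p z] r by (simp_all add: R_def)
  have "(R * (a * r))\<^sup>2 + (R * T)\<^sup>2 = 1"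
    using R(1) by (simp add: power_mult_distrib algebra_simps)
  then have "(R * (a * r))\<^sup>2 \<le> 1" using zero_le_power2[of "R * T"] by linarith
  then have le1: "R * (a * r) \<le> 1" by (simp add: abs_square_le_1)
  have "a * (R * (a * r)) * r \<le> a * 1 * r"
    using le1 a r(2) by (intro mult_left_mono mult_right_mono) auto
  also have "\<dots> \<le> (z - p) \<bullet> v" using z by (simp add: r_def)
  finally have *: "a\<^sup>2 * R * r\<^sup>2 \<le> (z - p) \<bullet> v" by (simp add: power2_eq_square mult_ac)
  have nn: "0 \<le> (z - p) \<bullet> v" using z a by (meson mult_nonneg_nonneg norm_ge_zero order_trans)
  have "(norm (s *\<^sub>R w - v))\<^sup>2 = s * (s * (w \<bullet> w) - 2 * (w \<bullet> v)) + 1" for s and w :: 'f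
    using v unfolding power2_norm_eq_inner
    by (simp add: norm_eq_1 inner_diff_left inner_diff_right inner_commute algebra_simps)
  from this[of "a\<^sup>2 * R" "z - p"]
  have "(norm (cone_grad T a p v z))\<^sup>2 = a\<^sup>2 * R * (a\<^sup>2 * R * r\<^sup>2 - 2 * ((z - p) \<bullet> v)) + 1"
    unfolding cone_grad_def R_def[symmetric] r(1) .
  also have "\<dots> \<le> 1"
  proof -
    have "a\<^sup>2 * R * (a\<^sup>2 * R * r\<^sup>2 - 2 * ((z - p) \<bullet> v)) \<le> 0"
      using * nn R(2) by (intro mult_nonneg_nonpos) auto
    then show ?thesis by simp
  qed
  finally show ?thesis by (simp add: abs_square_le_1)
qed

section \<open>The Hessian of the test function along the immersion\<close>

context local_immersion
begin

lemma pd_cone_fun: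
  assumes q: "q \<in> U" and T: "T > 0"
  shows "pd j (\<lambda>q. cone_fun T a p v (f q)) q = pd j f q \<bullet> cone_grad T a p v (f q)"
  using pd_eqI[OF has_derivative_cone_fun[OF smooth_on_has_derivative[OF f q] T]]
  by (simp add: cone_grad_def pd_def)

lemma has_derivative_cone_grad:
  assumes q: "q \<in> U" and T: "T > 0"
  shows "((\<lambda>q. cone_grad T a p v (f q)) has_derivative
    (\<lambda>w. (a\<^sup>2 * cone_inv_rad T a p (f q)) *\<^sub>R frechet_derivative f (at q) w
       - (a ^ 4 * cone_inv_rad T a p (f q) ^ 3 * (frechet_derivative f (at q) w \<bullet> (f q - p))) *\<^sub>R (f q - p))) (at q)"
proof -
  note D = smooth_on_has_derivative[OF f q]
  have "((\<lambda>q. f q - p) has_derivative frechet_derivative f (at q)) (at q)"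
    by (auto intro!: derivative_eq_intros D)
  from has_derivative_diff[OF has_derivative_scaleR[OF has_derivative_mult_right[OF has_derivative_cone_rad[OF D T], of "a\<^sup>2"] this]
      has_derivative_const[of v]]
  show ?thesis unfolding cone_grad_def
    by (simp add: power2_eq_square power4_eq_xxxx mult_ac)
qed

text \<open>Chain rule for Hessians: the Christoffel sum turns the second derivative of
  \<open>f\<close> paired with the gradient into \<open>sff\<close>, and the other two terms are the
  Euclidean Hessian of \<open>cone_fun\<close> on tangent vectors.\<close>

lemma cone_fun_hessian_coeff:
  assumes q: "q \<in> U" and T: "T > 0"
  shows "pd i (pd j (\<lambda>q. cone_fun T a p v (f q))) q
      - (\<Sum>k\<in>UNIV. gamma f k i j q * pd k (\<lambda>q. cone_fun T a p v (f q)) q) =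
    sff f i j q \<bullet> cone_grad T a p v (f q) + a\<^sup>2 * cone_inv_rad T a p (f q) * (pd i f q \<bullet> pd j f q)
    - a ^ 4 * cone_inv_rad T a p (f q) ^ 3 * ((pd i f q \<bullet> (f q - p)) * (pd j f q \<bullet> (f q - p)))"
proof -
  have "pd i (pd j (\<lambda>q. cone_fun T a p v (f q))) q = pd i (\<lambda>q. pd j f q \<bullet> cone_grad T a p v (f q)) q"
    by (rule pd_cong[OF U q]) (rule pd_cone_fun[OF _ T])
  also have "\<dots> = pd j f q \<bullet> pd i (\<lambda>q. cone_grad T a p v (f q)) q + pd i (pd j f) q \<bullet> cone_grad T a p v (f q)"
    using has_derivative_cone_grad[OF q T] by (intro pd_inner pd_differentiable[OF q]) (auto simp: differentiable_def)
  also have "pd i (\<lambda>q. cone_grad T a p v (f q)) q = (a\<^sup>2 * cone_inv_rad T a p (f q)) *\<^sub>R pd i f q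
       - (a ^ 4 * cone_inv_rad T a p (f q) ^ 3 * (pd i f q \<bullet> (f q - p))) *\<^sub>R (f q - p)"
    using pd_eqI[OF has_derivative_cone_grad[OF q T]] by (simp add: pd_def)
  finally show ?thesis
    unfolding pd_cone_fun[OF q T]
    by (simp add: sff_def inner_diff_left inner_diff_right inner_sum_left inner_commute[of "pd i f q" "pd j f q"] mult_ac)
qed

end

lemma (in isometrically_immersed) hessian_cone_fun:
  fixes p v :: 'f and T a :: real
  assumes x: "x \<in> topspace (mtop M)" and c: "c = chart_at M x" and T: "T > 0"
  defines "L \<equiv> frechet_derivative (\<phi> \<circ> coord_inv c) (at (coord c x))"
  shows "hessian M (\<lambda>y. cone_fun T a p v (\<phi> y)) x (tvec_of c x X) (tvec_of c x X) =
    second_form c x X X \<bullet> cone_grad T a p v (\<phi> x) + a\<^sup>2 * cone_inv_rad T a p (\<phi> x) * (L X \<bullet> L X)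
    - a ^ 4 * cone_inv_rad T a p (\<phi> x) ^ 3 * (L X \<bullet> (\<phi> x - p))\<^sup>2"
proof -
  have cx: "c \<in> charts_at M x" using chart_at_in[OF x] c by simp
  define f where "f = \<phi> \<circ> coord_inv c"
  define q where "q = coord c x"
  define W where "W = cone_grad T a p v (\<phi> x)"
  define z where "z = \<phi> x - p"
  interpret local_immersion f "coord c ` chart_dom c"
    unfolding f_def by (rule local_immersion_chart[OF charts_at_coord(5)[OF cx]])
  have qU: "q \<in> coord c ` chart_dom c" unfolding q_def by (rule charts_at_coord(1)[OF cx])
  have fq: "f q = \<phi> x" by (simp add: f_def q_def charts_at_coord[OF cx])
  have L: "L X = (\<Sum>i\<in>UNIV. X $ i *\<^sub>R pd i f q)"
    using frechet_derivative_eq_sum_pd[OF f_differentiable[OF qU]] by (simp add: L_def f_def q_def)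
  define A B where "A = a\<^sup>2 * cone_inv_rad T a p (\<phi> x)" and "B = a ^ 4 * cone_inv_rad T a p (\<phi> x) ^ 3"
  have "hessian M (\<lambda>y. cone_fun T a p v (\<phi> y)) x (tvec_of c x X) (tvec_of c x X) =
    (\<Sum>i\<in>UNIV. \<Sum>j\<in>UNIV. X $ i * X $ j * (sff f i j q \<bullet> W + A * (pd i f q \<bullet> pd j f q)
      - B * ((pd i f q \<bullet> z) * (pd j f q \<bullet> z))))"
    using hessian_eq[OF x c, of "\<lambda>y. cone_fun T a p v (\<phi> y)" "\<lambda>q. cone_fun T a p v (f q)"] charts_at_coord(4)
    unfolding f_def[symmetric] q_def[symmetric] cone_fun_hessian_coeff[OF qU T] fq W_def A_def B_def z_def
    by (simp add: tvec_of_self[OF cx] f_def)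
  also have "\<dots> = (\<Sum>i\<in>UNIV. \<Sum>j\<in>UNIV. X $ i * (X $ j * (sff f i j q \<bullet> W)))
      + A * (\<Sum>i\<in>UNIV. \<Sum>j\<in>UNIV. X $ i * (X $ j * (pd i f q \<bullet> pd j f q)))
      - B * (\<Sum>i\<in>UNIV. \<Sum>j\<in>UNIV. (X $ i * (pd i f q \<bullet> z)) * (X $ j * (pd j f q \<bullet> z)))"
    by (simp add: sum_distrib_left sum.distrib sum_subtractf algebra_simps)
  also have "(\<Sum>i\<in>UNIV. \<Sum>j\<in>UNIV. X $ i * (X $ j * (sff f i j q \<bullet> W))) = second_form c x X X \<bullet> W"
    by (simp add: second_form_def f_def[symmetric] q_def[symmetric] inner_sum_left sum_distrib_left)
  also have "(\<Sum>i\<in>UNIV. \<Sum>j\<in>UNIV. X $ i * (X $ j * (pd i f q \<bullet> pd j f q))) = L X \<bullet> L X"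
    unfolding L inner_sum_left unfolding inner_sum_right by (simp add: mult.left_commute)
  also have "(\<Sum>i\<in>UNIV. \<Sum>j\<in>UNIV. (X $ i * (pd i f q \<bullet> z)) * (X $ j * (pd j f q \<bullet> z))) = (L X \<bullet> z)\<^sup>2"
    unfolding L inner_sum_left power2_eq_square sum_product by simp
  finally show ?thesis by (simp add: A_def B_def W_def z_def)
qed

section \<open>The height of an immersed manifold in a cone\<close>

lemma nondeg_cone_inner:
  assumes "z \<in> nondeg_cone p v \<theta>"
  shows "cos \<theta> * norm (z - p) \<le> (z - p) \<bullet> v" "norm (z - p) > 0"
proof -
  show n: "norm (z - p) > 0" using assms by (simp add: nondeg_cone_def)
  have "cos \<theta> \<le> ((z - p) \<bullet> v) / norm (z - p)"
    using assms by (simp add: nondeg_cone_def divide_inverse mult.commute)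
  then show "cos \<theta> * norm (z - p) \<le> (z - p) \<bullet> v" using n by (simp add: pos_le_divide_eq)
qed

lemma Ck_manifold_cone_fun:
  fixes \<phi> :: "'a \<Rightarrow> 'f::euclidean_space" and M :: "('a, 'm::finite) rmanifold"
  assumes "isometrically_immersed M \<phi>" "T > 0"
  shows "Ck_manifold k M (\<lambda>y. cone_fun T a p v (\<phi> y))"
  unfolding Ck_manifold_def
proof
  fix c assume c: "c \<in> atlas M"
  interpret isometrically_immersed M \<phi> by fact
  interpret local_immersion "\<phi> \<circ> coord_inv c" "coord c ` chart_dom c"
    by (rule local_immersion_chart[OF c])
  have "Ck_on k (coord c ` chart_dom c) (\<phi> \<circ> coord_inv c)" using f by (simp add: smooth_on_def)
  from Ck_on_cone_fun[OF U this assms(2)]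
  show "Ck_on k (coord c ` chart_dom c) ((\<lambda>y. cone_fun T a p v (\<phi> y)) \<circ> coord_inv c)"
    by (simp add: comp_def)
qed

text \<open>Write r = |z - p|. The cone condition and positivity of \<open>cone_fun\<close> give (c
  r)^2 < Q, that is, (c r)^2 (1 - \<alpha>^2) < T^2. Multiplying by \<alpha>^2 and adding T^2 (1 -
  \<alpha>^2) yields Q (1 - \<alpha>^2) \<le> T^2.\<close>

lemma cone_inv_rad_lower_bound:
  fixes p v z :: "'f::real_inner"
  assumes T: "T > 0" and \<alpha>: "0 < \<alpha>" "\<alpha> < 1" and c: "c > 0" "c * norm (z - p) \<le> (z - p) \<bullet> v"
    and pos: "cone_fun T (\<alpha> * c) p v z > 0"
  shows "cone_inv_rad T (\<alpha> * c) p z \<ge> sqrt (1 - \<alpha>\<^sup>2) / T"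
proof -
  define r where "r = norm (z - p)"
  have r: "(z - p) \<bullet> (z - p) = r\<^sup>2" "r \<ge> 0" by (simp_all add: r_def power2_norm_eq_inner)
  define Q where "Q = T\<^sup>2 + (\<alpha> * c)\<^sup>2 * r\<^sup>2"
  have Q: "Q > 0" using T by (simp add: Q_def add_pos_nonneg)
  have \<alpha>2: "\<alpha>\<^sup>2 < 1" using \<alpha> by (simp add: abs_square_less_1)
  have "c * r < sqrt Q" using pos c(2) by (simp add: cone_fun_def r Q_def r_def[symmetric])
  then have "(c * r)\<^sup>2 < Q" using Q c(1) r(2) by (smt (verit) mult_nonneg_nonneg power_strict_mono real_sqrt_pow2 zero_less_numeral)
  then have "(c * r)\<^sup>2 * (1 - \<alpha>\<^sup>2) < T\<^sup>2" by (simp add: Q_def power_mult_distrib algebra_simps)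
  then have "\<alpha>\<^sup>2 * ((c * r)\<^sup>2 * (1 - \<alpha>\<^sup>2)) \<le> \<alpha>\<^sup>2 * T\<^sup>2" by (intro mult_left_mono) auto
  then have "Q * (1 - \<alpha>\<^sup>2) \<le> T\<^sup>2" by (simp add: Q_def power_mult_distrib algebra_simps)
  then have "sqrt (Q * (1 - \<alpha>\<^sup>2)) \<le> sqrt (T\<^sup>2)" by (rule real_sqrt_le_mono)
  then have "sqrt Q * sqrt (1 - \<alpha>\<^sup>2) \<le> T" using T by (simp add: real_sqrt_mult)
  then show ?thesis
    unfolding cone_inv_rad_def r Q_def[symmetric] using T Q by (simp add: field_simps)
qed

lemma cone_fun_le:
  fixes p v z :: "'f::real_inner"
  assumes T: "T > 0" and a: "0 \<le> a" "a * norm (z - p) \<le> (z - p) \<bullet> v"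
  shows "cone_fun T a p v z \<le> T"
proof -
  have "sqrt (T\<^sup>2 + (a * norm (z - p))\<^sup>2) \<le> T + a * norm (z - p)"
    using T a(1) by (intro real_le_lsqrt) (auto simp: power2_sum)
  then show ?thesis using a(2) by (simp add: cone_fun_def power_mult_distrib power2_norm_eq_inner)
qed

text \<open>The estimate at one point \<open>x0\<close> for one value of \<alpha>, which stays free
  so that it can later be optimised against \<open>const_A1\<close>.\<close>

lemma (in isometrically_immersed) cone_height_bound:
  fixes p v :: 'f and \<kappa> \<theta> \<alpha> :: real
  assumes wmp: "weak_max_principle_hessian M"
    and v: "norm v = 1" and \<theta>: "cos \<theta> > 0"
    and in_cone: "\<phi> ` topspace (mtop M) \<subseteq> nondeg_cone p v \<theta>"
    and codim: "DIM('f) < 2 * CARD('m)" and \<kappa>: "0 \<le> \<kappa>"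
    and sect: "\<And>x w z. x \<in> topspace (mtop M) \<Longrightarrow> w \<in> tangent_space M x \<Longrightarrow>
      z \<in> tangent_space M x \<Longrightarrow> tindep w z \<Longrightarrow> sect_curv M x w z \<le> \<kappa>\<^sup>2"
    and x0: "x0 \<in> topspace (mtop M)" and \<alpha>: "0 < \<alpha>" "\<alpha> < 1"
  shows "(cos \<theta>)\<^sup>2 * (\<alpha>\<^sup>2 * sqrt (1 - \<alpha>\<^sup>2) ^ 3) \<le> \<kappa> * ((\<phi> x0 - p) \<bullet> v)"
proof -
  define c where "c = cos \<theta>"
  define T where "T = (\<phi> x0 - p) \<bullet> v"
  define a where "a = \<alpha> * c"
  define u where "u y = cone_fun T a p v (\<phi> y)" for y
  have c: "c > 0" using \<theta> by (simp add: c_def)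
  have cone: "c * norm (\<phi> y - p) \<le> (\<phi> y - p) \<bullet> v" "norm (\<phi> y - p) > 0" if "y \<in> topspace (mtop M)" for y
    using nondeg_cone_inner[of "\<phi> y" p v \<theta>] in_cone that by (auto simp: c_def)
  have T: "T > 0" using cone[OF x0] c unfolding T_def by (smt (verit) mult_pos_pos)
  have a: "0 < a" "a \<le> c" using c \<alpha> by (simp_all add: a_def)
  have conea: "a * norm (\<phi> y - p) \<le> (\<phi> y - p) \<bullet> v" if "y \<in> topspace (mtop M)" for y
    using cone[OF that] a(2) by (meson mult_right_mono norm_ge_zero order_trans)
  have uT: "u y \<le> T" if "y \<in> topspace (mtop M)" for y
    unfolding u_def using cone_fun_le[OF T _ conea[OF that]] a by simp
  have bdd: "bdd_above (u ` topspace (mtop M))" using uT by (rule bdd_aboveI2)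
  have Ck: "Ck_manifold 2 M u"
    unfolding u_def by (rule Ck_manifold_cone_fun[OF isometrically_immersed_axioms T])
  from wmp[unfolded weak_max_principle_hessian_def, rule_format, OF conjI[OF Ck bdd]]
  obtain X where X: "\<And>k. k \<ge> 1 \<Longrightarrow> X k \<in> topspace (mtop M)"
    "\<And>k. k \<ge> 1 \<Longrightarrow> u (X k) > (SUP y\<in>topspace (mtop M). u y) - 1 / real k"
    "\<And>k. k \<ge> 1 \<Longrightarrow> (SUP v\<in>unit_tangent M (X k). ereal (hessian M u (X k) v v)) < ereal (1 / real k)"
    by blast
  \<comment> \<open>As \<open>T\<close> is the height of \<phi> x0 itself, the square root in
    \<open>u x0\<close> exceeds exactly the height subtracted from it.\<close>
  have u0: "u x0 > 0"
  proof -
    have "sqrt (T\<^sup>2) < sqrt (T\<^sup>2 + a\<^sup>2 * ((\<phi> x0 - p) \<bullet> (\<phi> x0 - p)))"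
      using a cone(2)[OF x0] by (intro real_sqrt_less_mono) simp
    then show ?thesis using T by (simp add: u_def cone_fun_def T_def[symmetric])
  qed
  \<comment> \<open>The condition 1/k < u x0 makes \<open>u (X k)\<close> positive, since it exceeds
    sup u - 1/k \<ge> u x0 - 1/k. Positivity is what bounds \<open>R\<close> from below.\<close>
  have key: "a\<^sup>2 * sqrt (1 - \<alpha>\<^sup>2) ^ 3 / T - \<kappa> \<le> 1 / real k" if k: "k \<ge> 1" "1 / real k < u x0" for k
  proof -
    let ?x = "X k"
    note x = X(1)[OF k(1)]
    define d where "d = chart_at M ?x"
    have dx: "d \<in> charts_at M ?x" unfolding d_def by (rule chart_at_in[OF x])
    let ?L = "frechet_derivative (\<phi> \<circ> coord_inv d) (at (coord d ?x))"
    obtain Y where Y: "norm (?L Y) = 1" "norm (second_form d ?x Y Y) \<le> \<kappa>"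
      using exists_small_second_form[OF x d_def codim \<kappa> sect[OF x]] by blast
    define R z where "R = cone_inv_rad T a p (\<phi> ?x)" and "z = \<phi> ?x - p"
    have "u x0 \<le> (SUP y\<in>topspace (mtop M). u y)" by (rule cSUP_upper[OF x0 bdd])
    then have upos: "u ?x > 0" using X(2)[OF k(1)] k(2) by linarith
    have R: "R \<ge> sqrt (1 - \<alpha>\<^sup>2) / T"
      unfolding R_def a_def using cone_inv_rad_lower_bound[OF T \<alpha> c cone(1)[OF x]] upos by (simp add: u_def a_def)
    have Rsq: "R\<^sup>2 * (T\<^sup>2 + a\<^sup>2 * (z \<bullet> z)) = 1" "R > 0"
      unfolding R_def z_def by (rule cone_inv_rad_sq[OF T])+
    have "tvec_of d ?x Y \<in> unit_tangent M ?x"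
      using Y(1) by (simp add: unit_tangent_def tvec_of_tangent[OF dx] metric_tvec_of[OF dx] norm_eq_1)
    \<comment> \<open>The supremum lives in \<open>ereal\<close>, so it dominates each term without
      any boundedness argument.\<close>
    then have "ereal (hessian M u ?x (tvec_of d ?x Y) (tvec_of d ?x Y)) < ereal (1 / real k)"
      using le_less_trans[OF SUP_upper[where f = "\<lambda>v. ereal (hessian M u ?x v v)"] X(3)[OF k(1)]] by blast
    then have "hessian M u ?x (tvec_of d ?x Y) (tvec_of d ?x Y) < 1 / real k" by simp
    moreover have "hessian M u ?x (tvec_of d ?x Y) (tvec_of d ?x Y) =
      second_form d ?x Y Y \<bullet> cone_grad T a p v (\<phi> ?x) + a\<^sup>2 * R - a ^ 4 * R ^ 3 * (?L Y \<bullet> z)\<^sup>2"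
      unfolding u_def hessian_cone_fun[OF x d_def T] R_def z_def using Y(1) by (simp add: norm_eq_1)
    moreover have "second_form d ?x Y Y \<bullet> cone_grad T a p v (\<phi> ?x) \<ge> - \<kappa>"
    proof -
      have "\<bar>second_form d ?x Y Y \<bullet> cone_grad T a p v (\<phi> ?x)\<bar>
        \<le> norm (second_form d ?x Y Y) * norm (cone_grad T a p v (\<phi> ?x))" by (rule Cauchy_Schwarz_ineq2)
      also have "\<dots> \<le> \<kappa> * 1"
        using norm_cone_grad_le[OF v T _ conea[OF x]] a(1) by (intro mult_mono Y(2) \<kappa>) auto
      finally show ?thesis by simp
    qed
    \<comment> \<open>Cauchy-Schwarz for the unit vector \<open>?L Y\<close> replaces the last
      square by |z|^2; the identity \<open>Rsq\<close> then leaves exactly the stated lower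
      bound.\<close>
    moreover have "a\<^sup>2 * R - a ^ 4 * R ^ 3 * (?L Y \<bullet> z)\<^sup>2 \<ge> a\<^sup>2 * T\<^sup>2 * R ^ 3"
    proof -
      have "(?L Y \<bullet> z)\<^sup>2 \<le> z \<bullet> z"
        using Cauchy_Schwarz_ineq[of "?L Y" z] Y(1) by (simp add: norm_eq_1)
      then have "a ^ 4 * R ^ 3 * (?L Y \<bullet> z)\<^sup>2 \<le> a ^ 4 * R ^ 3 * (z \<bullet> z)"
        using Rsq(2) by (intro mult_left_mono) auto
      moreover have "a\<^sup>2 * T\<^sup>2 * R ^ 3 + a ^ 4 * R ^ 3 * (z \<bullet> z) = a\<^sup>2 * R * (R\<^sup>2 * (T\<^sup>2 + a\<^sup>2 * (z \<bullet> z)))"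
        by (simp add: power2_eq_square power3_eq_cube power4_eq_xxxx algebra_simps)
      ultimately show ?thesis unfolding Rsq(1) by simp
    qed
    \<comment> \<open>Cubing the lower bound for \<open>R\<close> gives \<open>T ^ 3\<close> in the
      denominator, of which two factors cancel.\<close>
    moreover have "a\<^sup>2 * T\<^sup>2 * R ^ 3 \<ge> a\<^sup>2 * sqrt (1 - \<alpha>\<^sup>2) ^ 3 / T"
    proof -
      have "(sqrt (1 - \<alpha>\<^sup>2) / T) ^ 3 \<le> R ^ 3"
        using R T \<alpha> by (intro power_mono) (auto simp: abs_square_le_1)
      then have "a\<^sup>2 * T\<^sup>2 * (sqrt (1 - \<alpha>\<^sup>2) / T) ^ 3 \<le> a\<^sup>2 * T\<^sup>2 * R ^ 3"
        by (intro mult_left_mono) auto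
      moreover have "a\<^sup>2 * T\<^sup>2 * (sqrt (1 - \<alpha>\<^sup>2) / T) ^ 3 = a\<^sup>2 * sqrt (1 - \<alpha>\<^sup>2) ^ 3 / T"
        using T by (simp add: power_divide power2_eq_square power3_eq_cube)
      ultimately show ?thesis by simp
    qed
    ultimately show ?thesis by linarith
  qed
  have "a\<^sup>2 * sqrt (1 - \<alpha>\<^sup>2) ^ 3 / T - \<kappa> \<le> 0"
  proof (rule field_le_epsilon)
    fix e :: real assume e: "0 < e"
    \<comment> \<open>One small number serves both the condition of \<open>key\<close> and the final
      bound; \<open>Suc n\<close> keeps the index at least 1.\<close>
    define d where "d = min e (u x0)"
    have "d > 0" using e u0 by (simp add: d_def)
    then obtain n where n: "inverse (real (Suc n)) < d" using reals_Archimedean by blast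
    then have "a\<^sup>2 * sqrt (1 - \<alpha>\<^sup>2) ^ 3 / T - \<kappa> \<le> 1 / real (Suc n)"
      by (intro key) (auto simp: d_def inverse_eq_divide)
    then show "a\<^sup>2 * sqrt (1 - \<alpha>\<^sup>2) ^ 3 / T - \<kappa> \<le> 0 + e" using n by (simp add: d_def inverse_eq_divide)
  qed
  then show ?thesis
    using T by (simp add: a_def c_def[symmetric] T_def[symmetric] field_simps power_mult_distrib)
qed

text \<open>From \<alpha> < sqrt (1 - \<xi>) follows \<xi> < 1 - \<alpha>^2, so replacing \<xi> by 1
  - \<alpha>^2 enlarges each member of the defining set to
  \<open>\<alpha>\<^sup>2 * sqrt (1 - \<alpha>\<^sup>2) ^ 3\<close>.\<close>

lemma
  shows const_A1_pos: "const_A1 > 0"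
    and const_A1_le: "\<And>B. (\<And>\<alpha>. 0 < \<alpha> \<Longrightarrow> \<alpha> < 1 \<Longrightarrow> \<alpha>\<^sup>2 * sqrt (1 - \<alpha>\<^sup>2) ^ 3 \<le> B) \<Longrightarrow> const_A1 \<le> B"
proof -
  define S where "S = {\<xi> * \<alpha>\<^sup>2 * sqrt (1 - \<alpha>\<^sup>2) | \<xi> \<alpha>. 0 < \<xi> \<and> \<xi> < 1 \<and> 0 < \<alpha> \<and> \<alpha> < sqrt (1 - \<xi>)}"
  have A1: "const_A1 = Sup S" by (simp add: const_A1_def S_def)
  have le: "s \<le> B" if s: "s \<in> S" and B: "\<And>\<alpha>. 0 < \<alpha> \<Longrightarrow> \<alpha> < 1 \<Longrightarrow> \<alpha>\<^sup>2 * sqrt (1 - \<alpha>\<^sup>2) ^ 3 \<le> B" for s B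
  proof -
    obtain \<xi> \<alpha> where s: "s = \<xi> * \<alpha>\<^sup>2 * sqrt (1 - \<alpha>\<^sup>2)" "0 < \<xi>" "\<xi> < 1" "0 < \<alpha>" "\<alpha> < sqrt (1 - \<xi>)"
      using s unfolding S_def by blast
    have "\<alpha>\<^sup>2 < (sqrt (1 - \<xi>))\<^sup>2" using s(4,5) by (intro power_strict_mono) auto
    then have \<xi>: "\<xi> < 1 - \<alpha>\<^sup>2" using s(3) by simp
    then have \<alpha>: "\<alpha>\<^sup>2 < 1" using s(2) by linarith
    then have "\<alpha> < 1" using s(4) by (simp add: abs_square_less_1)
    have "s \<le> (1 - \<alpha>\<^sup>2) * \<alpha>\<^sup>2 * sqrt (1 - \<alpha>\<^sup>2)"
      unfolding s(1) using \<xi> \<alpha> by (intro mult_right_mono) auto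
    also have "\<dots> = \<alpha>\<^sup>2 * sqrt (1 - \<alpha>\<^sup>2) ^ 3"
      using \<alpha> by (simp add: power3_eq_cube)
    also have "\<dots> \<le> B" by (rule B[OF s(4) \<open>\<alpha> < 1\<close>])
    finally show ?thesis .
  qed
  \<comment> \<open>Gives an upper bound of \<open>S\<close>, without which the real
    \<open>Sup\<close> need not dominate its members.\<close>
  have "\<alpha>\<^sup>2 * sqrt (1 - \<alpha>\<^sup>2) ^ 3 \<le> 1" if "0 < \<alpha>" "\<alpha> < 1" for \<alpha> :: real
    using that by (intro mult_le_one power_le_one) (auto simp: abs_square_le_1)
  then have bdd: "bdd_above S" using le by (intro bdd_aboveI[of _ 1]) blast
  \<comment> \<open>The member with \<xi> = \<alpha> = 1/2 shows both that \<open>S\<close> is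
    nonempty and that its supremum is positive.\<close>
  have half: "1 / 2 < sqrt (1 - 1 / 2 :: real)" by (rule real_less_rsqrt) (simp add: power2_eq_square)
  have "1 / 2 * (1 / 2)\<^sup>2 * sqrt (1 - (1 / 2)\<^sup>2) \<in> S"
    unfolding S_def by (rule CollectI, rule exI[of _ "1/2"], rule exI[of _ "1/2"])
      (use half in simp)
  then have ne: "S \<noteq> {}" and "1 / 2 * (1 / 2)\<^sup>2 * sqrt (1 - (1 / 2)\<^sup>2) \<le> const_A1"
    unfolding A1 using cSup_upper[OF _ bdd] by blast+
  moreover have "0 < 1 / 2 * (1 / 2)\<^sup>2 * sqrt (1 - (1 / 2 :: real)\<^sup>2)" by (simp add: power2_eq_square)
  ultimately show "const_A1 > 0" by linarith
  show "const_A1 \<le> B" if "\<And>\<alpha>. 0 < \<alpha> \<Longrightarrow> \<alpha> < 1 \<Longrightarrow> \<alpha>\<^sup>2 * sqrt (1 - \<alpha>\<^sup>2) ^ 3 \<le> B" for B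
    unfolding A1 using ne le that by (intro cSup_least) blast+
qed

text \<open>Heights along the unit vector \<open>v\<close> may be measured from any point of the
  hyperplane, and by Cauchy-Schwarz a height is at most the distance.\<close>

lemma setdist_hyperplane_ge:
  fixes p v :: "'f::euclidean_space"
  assumes v: "norm v = 1" and S: "S \<noteq> {}" "\<And>z. z \<in> S \<Longrightarrow> d \<le> (z - p) \<bullet> v"
  shows "d \<le> setdist (hyperplane_at p v) S"
proof (rule le_setdistI)
  \<comment> \<open>\<open>setdist\<close> is 0 by convention when a set is empty, hence the two
    nonemptiness goals.\<close>
  show "hyperplane_at p v \<noteq> {}" by (auto simp: hyperplane_at_def intro: exI[of _ p])
  show "S \<noteq> {}" by fact
  fix y z assume y: "y \<in> hyperplane_at p v" and z: "z \<in> S"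
  have "d \<le> (z - p) \<bullet> v" by (rule S(2)[OF z])
  also have "\<dots> = (z - y) \<bullet> v" using y by (simp add: hyperplane_at_def inner_diff_left)
  also have "\<dots> \<le> norm (z - y) * norm v" by (rule norm_cauchy_schwarz)
  finally show "d \<le> dist y z" using v by (simp add: dist_norm norm_minus_commute)
qed

theorem theorem1p14:
  fixes M :: "('a, 'm::finite) rmanifold"
    and \<phi> :: "'a \<Rightarrow> real ^ 'n"
    and p v :: "real ^ 'n"
    and \<theta> chi :: real
  assumes riem: "riemannian_manifold M"
    and conn: "connected_space (mtop M)"
    and nonempty: "topspace (mtop M) \<noteq> {}"
    and dim: "CARD('m) \<ge> 2"
    and wmp: "weak_max_principle_hessian M"
    and imm: "isometric_immersion M \<phi>"
    and v: "v \<in> sphere 0 1"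
    and theta: "\<theta> \<in> {0<..<pi / 2}"
    and in_cone: "\<phi> ` topspace (mtop M) \<subseteq> nondeg_cone p v \<theta>"
    and codim: "0 < int CARD('n) - int CARD('m)" "int CARD('n) - int CARD('m) < int CARD('m)"
    and chi_nonneg: "chi \<ge> 0"
    and sect: "\<And>x w z. x \<in> topspace (mtop M) \<Longrightarrow> w \<in> tangent_space M x \<Longrightarrow>
      z \<in> tangent_space M x \<Longrightarrow> tindep w z \<Longrightarrow> sect_curv M x w z \<le> chi\<^sup>2"
  shows "cos \<theta> \<le> sqrt (setdist (hyperplane_at p v) (\<phi> ` topspace (mtop M)) * (chi / const_A1))"
proof -
  interpret isometrically_immersed M \<phi>
    using riem imm by unfold_locales
  have cos: "cos \<theta> > 0" using theta by (intro cos_gt_zero) auto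
  have v1: "norm v = 1" using v by simp
  have codim': "DIM(real ^ 'n) < 2 * CARD('m)" using codim by simp
  have A1: "(cos \<theta>)\<^sup>2 * const_A1 \<le> chi * ((\<phi> x - p) \<bullet> v)" if x: "x \<in> topspace (mtop M)" for x
  proof -
    \<comment> \<open>Dividing by the squared cosine leaves a bound independent of \<alpha>, as
      \<open>const_A1_le\<close> asks.\<close>
    have "const_A1 \<le> chi * ((\<phi> x - p) \<bullet> v) / (cos \<theta>)\<^sup>2"
    proof (rule const_A1_le)
      fix \<alpha> :: real assume "0 < \<alpha>" "\<alpha> < 1"
      from cone_height_bound[OF wmp v1 cos in_cone codim' chi_nonneg sect x this]
      show "\<alpha>\<^sup>2 * sqrt (1 - \<alpha>\<^sup>2) ^ 3 \<le> chi * ((\<phi> x - p) \<bullet> v) / (cos \<theta>)\<^sup>2"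
        using cos by (simp add: field_simps)
    qed
    then show ?thesis using cos by (simp add: field_simps)
  qed
  obtain x0 where x0: "x0 \<in> topspace (mtop M)" using nonempty by blast
  \<comment> \<open>The left side of \<open>A1\<close> is positive, so \<open>chi\<close> cannot
    vanish and may be divided by.\<close>
  have "0 < (cos \<theta>)\<^sup>2 * const_A1" using cos const_A1_pos by simp
  then have "chi \<noteq> 0" using A1[OF x0] by auto
  then have chi: "chi > 0" using chi_nonneg by simp
  \<comment> \<open>After division by \<open>chi\<close> the bound on heights is uniform over the
    manifold and passes to the distance.\<close>
  have "(cos \<theta>)\<^sup>2 * const_A1 / chi \<le> setdist (hyperplane_at p v) (\<phi> ` topspace (mtop M))"
    using nonempty A1 chi by (intro setdist_hyperplane_ge v1) (auto simp: field_simps)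
  then have "(cos \<theta>)\<^sup>2 \<le> setdist (hyperplane_at p v) (\<phi> ` topspace (mtop M)) * (chi / const_A1)"
    using chi const_A1_pos by (simp add: field_simps)
  then show ?thesis by (rule real_le_rsqrt)
qed

end
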